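(* Let $G$ be a finite group acting transitively on a finite set $\Omega$ with $|\Omega|\geq 2$, let $S\subseteq G$ and $\Gamma\subseteq\Omega$ be non-empty. Then the following two chains of inequalities hold: $$|S(\Gamma)| > \frac{|\Omega|}{1+\frac{|G||\Omega|}{d_H|S||\Gamma|}} \geq \min\left\{\frac{|\Omega|}{2},\ \frac{d_H|S||\Gamma|}{2|G|}\right\};$$ $$|S(\Gamma)| > \frac{|\Omega|}{1+\frac{\ell_S|\Omega|^2}{m_H|S||\Gamma|}} \geq \min\left\{\frac{|\Omega|}{2},\ \frac{m_H|S||\Gamma|}{2\ell_S|\Omega|}\right\}.$$ In particular, if $k$ is a positive number and $|S|\geq\min\left\{k\frac{|G|}{d_H},\ k\frac{\ell_S|\Omega|}{m_H}\right\}$, then $|S(\Gamma)|>\frac12\min\{|\Omega|,\ k|\Gamma|\}$.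
   Context: Group actions are written on the left, and $S(\Gamma)=\{s\gamma \mid s\in S,\gamma\in\Gamma\}$. $H=\mathrm{Stab}_G(\omega)$ is the stabilizer in $G$ of some element $\omega\in\Omega$; $1_H^G$ is the (complex) permutation representation of $G$ on the left cosets of $H$ (equivalently, on $\Omega$). $d_H$ is the minimum degree of a non-trivial irreducible component of $1_H^G$, and $m_H$ is the minimum multiplicity, in $1_H^G$, of a non-trivial irreducible component of $1_H^G$. Finally $\ell_S=\max\{|g_1Hg_2\cap S| \mid g_1,g_2\in G\}$. *)

theory Defs
  imports Complex_Main "HOL-Algebra.Group_Action" "HOL-Library.Function_Algebras"
begin

text \<open>
  A complex representation \<open>\<rho>\<close> of the group \<open>G\<close> on the complex vector space \<open>V\<close>, realised as a
  subspace of an ambient complex vector space with scalar multiplication \<open>scale\<close>.  The behaviour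
  of \<open>\<rho> g\<close> is only constrained on \<open>V\<close>.
\<close>

locale complex_representation = group G + vector_space scale
  for G (structure) and scale :: "complex \<Rightarrow> 'v::ab_group_add \<Rightarrow> 'v" +
  fixes V :: "'v set" and \<rho> :: "'a \<Rightarrow> 'v \<Rightarrow> 'v"
  assumes subspace_V: "subspace V"
    and rep_closed: "\<lbrakk>g \<in> carrier G; v \<in> V\<rbrakk> \<Longrightarrow> \<rho> g v \<in> V"
    and rep_add: "\<lbrakk>g \<in> carrier G; u \<in> V; v \<in> V\<rbrakk> \<Longrightarrow> \<rho> g (u + v) = \<rho> g u + \<rho> g v"
    and rep_scale: "\<lbrakk>g \<in> carrier G; v \<in> V\<rbrakk> \<Longrightarrow> \<rho> g (scale c v) = scale c (\<rho> g v)"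
    and rep_one: "v \<in> V \<Longrightarrow> \<rho> \<one> v = v"
    and rep_mult: "\<lbrakk>g \<in> carrier G; h \<in> carrier G; v \<in> V\<rbrakk> \<Longrightarrow> \<rho> (g \<otimes> h) v = \<rho> g (\<rho> h v)"
begin

definition subrep :: "'v set \<Rightarrow> bool" where
  "subrep W \<longleftrightarrow> subspace W \<and> W \<subseteq> V \<and> (\<forall>g\<in>carrier G. \<forall>w\<in>W. \<rho> g w \<in> W)"

definition irreducible_subrep :: "'v set \<Rightarrow> bool" where
  "irreducible_subrep W \<longleftrightarrow>
     subrep W \<and> W \<noteq> {0} \<and> (\<forall>U. subrep U \<and> U \<subseteq> W \<longrightarrow> U = {0} \<or> U = W)"

definition trivial_subrep :: "'v set \<Rightarrow> bool" where
  "trivial_subrep W \<longleftrightarrow> subrep W \<and> dim W = 1 \<and> (\<forall>g\<in>carrier G. \<forall>w\<in>W. \<rho> g w = w)"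

definition subrep_iso :: "'v set \<Rightarrow> 'v set \<Rightarrow> bool" where
  "subrep_iso U W \<longleftrightarrow>
     (\<exists>T. bij_betw T U W \<and>
          (\<forall>u\<in>U. \<forall>v\<in>U. T (u + v) = T u + T v) \<and>
          (\<forall>c. \<forall>u\<in>U. T (scale c u) = scale c (T u)) \<and>
          (\<forall>g\<in>carrier G. \<forall>u\<in>U. T (\<rho> g u) = \<rho> g (T u)))"

text \<open>\<open>V\<close> is the internal direct sum of the finitely many irreducible subspaces in \<open>\<D>\<close>.\<close>

definition irreducible_decomposition :: "'v set set \<Rightarrow> bool" where
  "irreducible_decomposition \<D> \<longleftrightarrow>
     finite \<D> \<and> (\<forall>W\<in>\<D>. irreducible_subrep W) \<and> span (\<Union>\<D>) = V \<and>
     (\<forall>f. (\<forall>W\<in>\<D>. f W \<in> W) \<and> (\<Sum>W\<in>\<D>. f W) = 0 \<longrightarrow> (\<forall>W\<in>\<D>. f W = 0))"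

text \<open>
  The multiplicity of an irreducible \<open>W\<close> in \<open>V\<close> is the number of summands isomorphic to \<open>W\<close> in a
  decomposition of \<open>V\<close> into irreducibles.  By the Jordan--Hoelder theorem this number does not
  depend on which decomposition is chosen.
\<close>

definition multiplicity :: "'v set \<Rightarrow> nat" where
  "multiplicity W =
     card {U \<in> (SOME \<D>. irreducible_decomposition \<D>). subrep_iso U W}"

definition nontrivial_irreducible :: "'v set \<Rightarrow> bool" where
  "nontrivial_irreducible W \<longleftrightarrow> irreducible_subrep W \<and> \<not> trivial_subrep W"

definition min_degree :: nat where
  "min_degree = (LEAST d. \<exists>W. nontrivial_irreducible W \<and> d = dim W)"

definition min_multiplicity :: nat where
  "min_multiplicity = (LEAST m. \<exists>W. nontrivial_irreducible W \<and> m = multiplicity W)"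

end

text \<open>
  The permutation representation of a group action: the space of complex functions on \<open>\<Omega>\<close>
  (extended by \<open>0\<close> outside \<open>\<Omega>\<close>), on which \<open>g\<close> sends the indicator function of a point \<open>x\<close> to the
  indicator function of \<open>g x\<close>.
\<close>

definition fun_scale :: "complex \<Rightarrow> ('b \<Rightarrow> complex) \<Rightarrow> 'b \<Rightarrow> complex" where
  "fun_scale c f = (\<lambda>x. c * f x)"

definition perm_space :: "'b set \<Rightarrow> ('b \<Rightarrow> complex) set" where
  "perm_space \<Omega> = {f. \<forall>x. x \<notin> \<Omega> \<longrightarrow> f x = 0}"

definition perm_rep ::
  "('a, 'm) monoid_scheme \<Rightarrow> 'b set \<Rightarrow> ('a \<Rightarrow> 'b \<Rightarrow> 'b) \<Rightarrow> 'a \<Rightarrow> ('b \<Rightarrow> complex) \<Rightarrow> 'b \<Rightarrow> complex" where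
  "perm_rep G \<Omega> \<phi> g f = (\<lambda>x. if x \<in> \<Omega> then f (\<phi> (inv\<^bsub>G\<^esub> g) x) else 0)"

lemma vector_space_fun_scale: "vector_space fun_scale"
  by unfold_locales (auto simp: fun_scale_def fun_eq_iff algebra_simps)

lemma complex_representation_perm_rep:
  assumes "group_action G \<Omega> \<phi>"
  shows "complex_representation G fun_scale (perm_space \<Omega>) (perm_rep G \<Omega> \<phi>)"
proof -
  interpret group_action G \<Omega> \<phi> by fact
  interpret group_hom G "BijGroup \<Omega>" \<phi> by (rule group_hom)
  interpret vector_space fun_scale by (rule vector_space_fun_scale)
  show ?thesis
  proof unfold_locales
    show "subspace (perm_space \<Omega>)"
      by (auto simp: subspace_def perm_space_def fun_scale_def)
  next
    fix g f assume "g \<in> carrier G" "f \<in> perm_space \<Omega>"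
    show "perm_rep G \<Omega> \<phi> g f \<in> perm_space \<Omega>"
      by (simp add: perm_rep_def perm_space_def)
  next
    fix f assume f: "f \<in> perm_space \<Omega>"
    have "\<phi> \<one>\<^bsub>G\<^esub> x = x" if "x \<in> \<Omega>" for x
      using that id_eq_one by (metis restrict_apply')
    then show "perm_rep G \<Omega> \<phi> \<one>\<^bsub>G\<^esub> f = f"
      using f by (auto simp: perm_rep_def perm_space_def fun_eq_iff)
  next
    fix g h f assume g: "g \<in> carrier G" and h: "h \<in> carrier G" and "f \<in> perm_space \<Omega>"
    have *: "inv\<^bsub>G\<^esub> (g \<otimes>\<^bsub>G\<^esub> h) = inv\<^bsub>G\<^esub> h \<otimes>\<^bsub>G\<^esub> inv\<^bsub>G\<^esub> g"
      using g h by (rule G.inv_mult_group)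
    have "\<phi> (inv\<^bsub>G\<^esub> (g \<otimes>\<^bsub>G\<^esub> h)) x = \<phi> (inv\<^bsub>G\<^esub> h) (\<phi> (inv\<^bsub>G\<^esub> g) x)"
      if "x \<in> \<Omega>" for x
      unfolding * by (rule composition_rule[OF that G.inv_closed[OF h] G.inv_closed[OF g]])
    moreover have "\<phi> (inv\<^bsub>G\<^esub> g) x \<in> \<Omega>" if "x \<in> \<Omega>" for x
      by (rule element_image[OF G.inv_closed[OF g] that refl])
    ultimately show "perm_rep G \<Omega> \<phi> (g \<otimes>\<^bsub>G\<^esub> h) f = perm_rep G \<Omega> \<phi> g (perm_rep G \<Omega> \<phi> h f)"
      unfolding perm_rep_def fun_eq_iff by simp
  qed (auto simp: perm_rep_def fun_scale_def fun_eq_iff)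
qed

definition perm_min_degree ::
  "('a, 'm) monoid_scheme \<Rightarrow> 'b set \<Rightarrow> ('a \<Rightarrow> 'b \<Rightarrow> 'b) \<Rightarrow> nat" where
  "perm_min_degree G \<Omega> \<phi> =
     complex_representation.min_degree G fun_scale (perm_space \<Omega>) (perm_rep G \<Omega> \<phi>)"

definition perm_min_multiplicity ::
  "('a, 'm) monoid_scheme \<Rightarrow> 'b set \<Rightarrow> ('a \<Rightarrow> 'b \<Rightarrow> 'b) \<Rightarrow> nat" where
  "perm_min_multiplicity G \<Omega> \<phi> =
     complex_representation.min_multiplicity G fun_scale (perm_space \<Omega>) (perm_rep G \<Omega> \<phi>)"

definition max_translate_inter ::
  "('a, 'm) monoid_scheme \<Rightarrow> 'a set \<Rightarrow> 'a set \<Rightarrow> nat" where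
  "max_translate_inter G H S =
     Max {card ((g1 <#\<^bsub>G\<^esub> H #>\<^bsub>G\<^esub> g2) \<inter> S) | g1 g2. g1 \<in> carrier G \<and> g2 \<in> carrier G}"

definition set_act :: "('a \<Rightarrow> 'b \<Rightarrow> 'b) \<Rightarrow> 'a set \<Rightarrow> 'b set \<Rightarrow> 'b set" where
  "set_act \<phi> S \<Gamma> = {\<phi> s \<gamma> | s \<gamma>. s \<in> S \<and> \<gamma> \<in> \<Gamma>}"

end

theory Submission
  imports Defs "HOL-Analysis.Function_Topology" "HOL-Analysis.Topology_Euclidean_Space"
    "HOL-Analysis.Convex"
begin

text \<open>
  Let \<open>T\<close> be the sum of the operators \<open>\<rho> s\<close> over \<open>s \<in> S\<close>. The function \<open>T 1\<^bsub>\<Gamma>\<^esub>\<close> is supported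
  on \<open>S(\<Gamma>)\<close> and has sum \<open>|S||\<Gamma>|\<close>, so by Cauchy--Schwarz an inequality
  \<open>\<parallel>T f\<parallel>\<^sup>2 \<le> L |S| \<parallel>f\<parallel>\<^sup>2\<close> on the functions with sum zero gives \<open>|S(\<Gamma>)| > |\<Omega>| / (1 + L |\<Omega>| / (|S||\<Gamma>|))\<close>.

  For \<open>L = |G| / d\<close>, fix \<open>v\<close> and consider the form \<open>w \<mapsto> \<Sum>\<^sub>g |\<langle>w, \<rho> g v\<rangle>|\<^sup>2\<close>. It is
  \<open>G\<close>-invariant, hence so is its top eigenspace in the functions with sum zero. By transitivity
  this space has no non-zero fixed vectors, so it contains a non-trivial irreducible and has
  dimension at least \<open>d\<close>; the trace of the form is \<open>|G| \<parallel>v\<parallel>\<^sup>2\<close>.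

  For \<open>L = \<ell> |\<Omega>| / m\<close>, take an eigenvector of \<open>T\<^sup>* T\<close> for its top eigenvalue on the functions with
  sum zero. It has a non-zero component in some non-trivial irreducible summand of the
  permutation representation. As \<open>T\<^sup>* T\<close> lies in the group algebra, isomorphisms carry this
  component to eigenvectors in all the summands isomorphic to that one, so the eigenvalue has
  multiplicity at least \<open>m\<close>. The trace of \<open>T\<^sup>* T\<close> is the sum of the squares of the matrix entries
  of \<open>T\<close>, which are at most \<open>\<ell>\<close> and add up to \<open>|S||\<Omega>|\<close>.
\<close>

section \<open>Complex representations\<close>

context complex_representation
begin

section \<open>Linear algebra inside a representation and minimal subrepresentations\<close>

lemma rep_zero: "g \<in> carrier G \<Longrightarrow> \<rho> g 0 = 0"
  using rep_scale[of g 0 0] subspace_0[OF subspace_V] by simp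

lemma rep_sum:
  assumes "g \<in> carrier G" "\<And>i. i \<in> I \<Longrightarrow> f i \<in> V"
  shows "\<rho> g (\<Sum>i\<in>I. f i) = (\<Sum>i\<in>I. \<rho> g (f i))"
  using assms(2)
proof (induction I rule: infinite_finite_induct)
  case (insert i I)
  then show ?case
    using rep_add[OF assms(1)] subspace_sum[OF subspace_V, of I f] by simp
qed (use assms(1) rep_zero in auto)

lemma subrepD:
  assumes "subrep W"
  shows "subspace W" "W \<subseteq> V" "\<And>g w. g \<in> carrier G \<Longrightarrow> w \<in> W \<Longrightarrow> \<rho> g w \<in> W"
  using assms by (auto simp: subrep_def)

lemma subrep_0: "subrep W \<Longrightarrow> 0 \<in> W"
  by (simp add: subrepD subspace_0)

lemma irreducible_subrep_imp_subrep: "irreducible_subrep W \<Longrightarrow> subrep W"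
  by (simp add: irreducible_subrep_def)

text \<open>The ambient space may be infinite-dimensional. A finite set \<open>F\<close> whose span
  contains \<open>V\<close> stands in for finite dimension: it makes every basis of \<open>X\<close>
  finite, and then the exchange bound applies.\<close>

lemma independent_card_le_dim:
  assumes "finite F" "V \<subseteq> span F" "X \<subseteq> V" "B \<subseteq> X" "independent B"
  shows "finite B \<and> card B \<le> dim X"
proof -
  obtain C where C: "C \<subseteq> X" "independent C" "X \<subseteq> span C" "card C = dim X"
    using basis_exists by blast
  have "finite C"
    using independent_span_bound[OF assms(1) C(2)] C(1) assms(2,3) by blast
  then show ?thesis
    using independent_span_bound[OF _ assms(5), of C] C assms(4) by force
qed

text \<open>A vector of \<open>X\<close> outside \<open>U\<close> would extend a basis of
  \<open>U\<close> to an independent subset of \<open>X\<close> with more than \<open>dim X\<close>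
  elements.\<close>

lemma subspace_eq_of_dim_le:
  assumes "finite F" "V \<subseteq> span F" "X \<subseteq> V" "U \<subseteq> X" "subspace U" "dim X \<le> dim U"
  shows "U = X"
proof (rule ccontr)
  assume "U \<noteq> X"
  then obtain x where x: "x \<in> X" "x \<notin> U"
    using assms(4) by blast
  obtain B where B: "B \<subseteq> U" "independent B" "U \<subseteq> span B" "card B = dim U"
    using basis_exists by blast
  have "span B \<subseteq> U"
    using B(1) assms(5) by (rule span_minimal)
  then have "x \<notin> span B"
    using x by blast
  then have "independent (insert x B)" "x \<notin> B"
    using B(2) independent_insertI span_base by blast+
  moreover have "insert x B \<subseteq> X"
    using x B assms(4) by auto
  ultimately have "finite B" "card (insert x B) \<le> dim X"
    using independent_card_le_dim[OF assms(1-3), of "insert x B"] by auto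
  then show False
    using \<open>x \<notin> B\<close> B(4) assms(6) by simp
qed

text \<open>Among the non-zero subrepresentations inside \<open>X\<close>, one of least dimension is
  irreducible, because a non-zero subrepresentation of it has no smaller dimension and therefore
  equals it.\<close>

lemma irreducible_subrep_exists:
  assumes "finite F" "V \<subseteq> span F" "subrep X" "X \<noteq> {0}"
  obtains W where "irreducible_subrep W" "W \<subseteq> X"
proof -
  define P where "P W \<longleftrightarrow> subrep W \<and> W \<subseteq> X \<and> W \<noteq> {0}" for W
  have "P X"
    using assms by (simp add: P_def)
  then obtain W where W: "P W" "\<And>U. P U \<Longrightarrow> dim W \<le> dim U"
    using ex_has_least_nat[of P X dim] by blast
  have "U = W" if "subrep U" "U \<subseteq> W" "U \<noteq> {0}" for U
    using subspace_eq_of_dim_le[OF assms(1,2) _ that(2)] W(1) W(2)[of U] that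
    by (auto simp: P_def subrepD)
  then have "irreducible_subrep W"
    using W(1) unfolding irreducible_subrep_def P_def by blast
  with W(1) show ?thesis
    using that by (auto simp: P_def)
qed

subsection \<open>Direct sums of subspaces\<close>

text \<open>The independence clause of \<open>irreducible_decomposition\<close>, isolated so that
  families that do not yet span \<open>V\<close> can be enlarged step by step.\<close>

definition direct :: "'v set set \<Rightarrow> bool" where
  "direct \<D> \<longleftrightarrow> (\<forall>f. (\<forall>W\<in>\<D>. f W \<in> W) \<and> (\<Sum>W\<in>\<D>. f W) = 0 \<longrightarrow> (\<forall>W\<in>\<D>. f W = 0))"

lemma directD: "direct \<D> \<Longrightarrow> (\<And>W. W \<in> \<D> \<Longrightarrow> f W \<in> W) \<Longrightarrow> (\<Sum>W\<in>\<D>. f W) = 0 \<Longrightarrow> W \<in> \<D> \<Longrightarrow> f W = 0"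
  unfolding direct_def by blast

text \<open>A choice of vectors on the subfamily is extended by zero to the whole family.\<close>

lemma direct_mono:
  assumes "finite \<D>" "direct \<D>" "\<And>W. W \<in> \<D> \<Longrightarrow> subspace W" "\<E> \<subseteq> \<D>"
  shows "direct \<E>"
  unfolding direct_def
proof (intro allI impI ballI)
  fix f W assume f: "(\<forall>W\<in>\<E>. f W \<in> W) \<and> (\<Sum>W\<in>\<E>. f W) = 0" and W: "W \<in> \<E>"
  define f' where "f' U = (if U \<in> \<E> then f U else 0)" for U
  have "(\<Sum>U\<in>\<D>. f' U) = (\<Sum>U\<in>\<E>. f U)"
    using assms(1,4) by (intro sum.mono_neutral_cong_right) (auto simp: f'_def)
  then have "f' W = 0"
    using f W assms(3,4) by (intro directD[OF assms(2), where f = f']) (auto simp: f'_def subspace_0)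
  then show "f W = 0"
    using W by (simp add: f'_def)
qed

text \<open>In a vanishing sum the component in \<open>W0\<close> is minus the sum of the others, so
  it lies in the intersection with their span and vanishes.\<close>

lemma direct_insert:
  assumes "finite \<D>" "direct \<D>" "W0 \<notin> \<D>" "subspace W0" "W0 \<inter> span (\<Union>\<D>) = {0}"
  shows "direct (insert W0 \<D>)"
  unfolding direct_def
proof (intro allI impI ballI)
  fix f W assume f: "(\<forall>W\<in>insert W0 \<D>. f W \<in> W) \<and> (\<Sum>W\<in>insert W0 \<D>. f W) = 0" and W: "W \<in> insert W0 \<D>"
  have s: "(\<Sum>W\<in>\<D>. f W) \<in> span (\<Union>\<D>)"
    using f by (intro span_sum span_base) auto
  have "f W0 = - (\<Sum>W\<in>\<D>. f W)"
    using f assms(1,3) by (simp add: eq_neg_iff_add_eq_0)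
  then have "f W0 \<in> W0 \<inter> span (\<Union>\<D>)"
    using f span_neg[OF s] by auto
  then have "f W0 = 0"
    using assms(5) by blast
  moreover from this have "(\<Sum>W\<in>\<D>. f W) = 0"
    using f assms(1,3) by simp
  ultimately show "f W = 0"
    using directD[OF assms(2), of f W] f W by auto
qed

lemma direct_independent:
  assumes "finite \<D>" "direct \<D>" "\<And>W. W \<in> \<D> \<Longrightarrow> subspace W"
    and "\<And>W. W \<in> \<D> \<Longrightarrow> v W \<in> W" "\<And>W. W \<in> \<D> \<Longrightarrow> v W \<noteq> 0"
  shows "inj_on v \<D>" "independent (v ` \<D>)"
proof -
  show inj: "inj_on v \<D>"
  proof (rule inj_onI, rule ccontr)
    fix U W assume UW: "U \<in> \<D>" "W \<in> \<D>" "v U = v W" "U \<noteq> W"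
    define f where "f X = (if X = U then v U else if X = W then - v W else 0)" for X
    have "(\<Sum>X\<in>\<D>. f X) = (\<Sum>X\<in>{U, W}. f X)"
      using UW assms(1) by (intro sum.mono_neutral_right) (auto simp: f_def)
    also have "\<dots> = 0"
      using UW by (simp add: f_def)
    finally have "(\<Sum>X\<in>\<D>. f X) = 0" .
    moreover have "f X \<in> X" if "X \<in> \<D>" for X
      using that UW(4) assms(4)[of X] subspace_0[OF assms(3)] subspace_neg[OF assms(3)] by (auto simp: f_def)
    ultimately have "f U = 0"
      using UW(1) by (intro directD[OF assms(2), where f = f])
    then show False
      using UW assms(5) by (simp add: f_def)
  qed
  show "independent (v ` \<D>)"
  proof (rule independent_if_scalars_zero)
    fix u x assume u: "(\<Sum>x\<in>v ` \<D>. scale (u x) x) = 0" and x: "x \<in> v ` \<D>"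
    then obtain W where W: "W \<in> \<D>" "x = v W" by blast
    have "(\<Sum>W\<in>\<D>. scale (u (v W)) (v W)) = 0"
      using u by (simp add: sum.reindex[OF inj])
    then have "scale (u (v W)) (v W) = 0"
      using W assms(3,4) by (intro directD[OF assms(2), of "\<lambda>W. scale (u (v W)) (v W)"]) (auto simp: subspace_scale)
    then show "u x = 0"
      using W assms(5) by auto
  qed (use assms(1) in auto)
qed

text \<open>The sums with one term from each member form a subspace that contains every member,
  hence the span.\<close>

lemma span_Union_subspaces:
  assumes "finite \<D>" "\<And>W. W \<in> \<D> \<Longrightarrow> subspace W" "v \<in> span (\<Union>\<D>)"
  obtains f where "\<And>W. W \<in> \<D> \<Longrightarrow> f W \<in> W" "v = (\<Sum>W\<in>\<D>. f W)"
proof -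
  let ?X = "{\<Sum>W\<in>\<D>. f W | f. \<forall>W\<in>\<D>. f W \<in> W}"
  have "subspace ?X"
    unfolding subspace_def
  proof (intro conjI ballI allI)
    show "0 \<in> ?X"
      using assms(2) by (intro CollectI exI[of _ "\<lambda>_. 0"]) (auto simp: subspace_0)
  next
    fix x y assume "x \<in> ?X" "y \<in> ?X"
    then obtain f g where "x = (\<Sum>W\<in>\<D>. f W)" "y = (\<Sum>W\<in>\<D>. g W)" "\<forall>W\<in>\<D>. f W \<in> W" "\<forall>W\<in>\<D>. g W \<in> W"
      by blast
    then show "x + y \<in> ?X"
      using assms(2) by (intro CollectI exI[of _ "\<lambda>W. f W + g W"]) (auto simp: sum.distrib subspace_add)
  next
    fix c x assume "x \<in> ?X"
    then obtain f where "x = (\<Sum>W\<in>\<D>. f W)" "\<forall>W\<in>\<D>. f W \<in> W"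
      by blast
    then show "scale c x \<in> ?X"
      using assms(2) by (intro CollectI exI[of _ "\<lambda>W. scale c (f W)"]) (auto simp: scale_sum_right subspace_scale)
  qed
  moreover have "\<Union>\<D> \<subseteq> ?X"
  proof
    fix x assume "x \<in> \<Union>\<D>"
    then obtain W where W: "W \<in> \<D>" "x \<in> W" by blast
    then show "x \<in> ?X"
      using assms(1,2) by (intro CollectI exI[of _ "\<lambda>U. if U = W then x else 0"]) (auto simp: subspace_0)
  qed
  ultimately have "v \<in> ?X"
    using span_minimal assms(3) by blast
  then show ?thesis
    using that by blast
qed

section \<open>Existence of decompositions into irreducibles\<close>

lemma irreducible_decompositionD:
  assumes "irreducible_decomposition \<D>"
  shows "finite \<D>" "\<And>W. W \<in> \<D> \<Longrightarrow> irreducible_subrep W" "\<And>W. W \<in> \<D> \<Longrightarrow> subrep W"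
    "span (\<Union>\<D>) = V" "direct \<D>"
  using assms by (auto simp: irreducible_decomposition_def irreducible_subrep_def direct_def)

lemma subrep_span_Union:
  assumes "finite \<D>" "\<And>W. W \<in> \<D> \<Longrightarrow> subrep W"
  shows "subrep (span (\<Union>\<D>))"
  unfolding subrep_def
proof (intro conjI ballI)
  show "span (\<Union>\<D>) \<subseteq> V"
    using assms(2) by (intro span_minimal subspace_V) (auto dest: subrepD(2))
  fix g v assume g: "g \<in> carrier G" and "v \<in> span (\<Union>\<D>)"
  then obtain f where f: "\<And>W. W \<in> \<D> \<Longrightarrow> f W \<in> W" "v = (\<Sum>W\<in>\<D>. f W)"
    using assms subrepD(1) span_Union_subspaces by metis
  have "\<rho> g v = (\<Sum>W\<in>\<D>. \<rho> g (f W))"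
    unfolding f(2) using f(1) assms(2) subrepD(2) by (intro rep_sum g) blast
  also have "\<dots> \<in> span (\<Union>\<D>)"
    using f(1) assms(2) g subrepD(3) by (intro span_sum span_base) blast
  finally show "\<rho> g v \<in> span (\<Union>\<D>)" .
qed auto

text \<open>A direct family of irreducibles has at most \<open>dim V\<close> members, as non-zero
  vectors picked from them are independent. If a largest family did not span \<open>V\<close>, then
  \<open>compl\<close> would provide a subrepresentation meeting its span trivially, and an
  irreducible inside that could be added. \<open>compl\<close> is the abstract form of complete
  reducibility.\<close>

lemma irreducible_decomposition_exists:
  assumes "finite F" "V \<subseteq> span F"
    and compl: "\<And>Y. subrep Y \<Longrightarrow> Y \<noteq> V \<Longrightarrow> \<exists>X. subrep X \<and> X \<noteq> {0} \<and> X \<inter> Y = {0}"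
  shows "\<exists>\<D>. irreducible_decomposition \<D>"
proof -
  define P where "P \<D> \<longleftrightarrow> finite \<D> \<and> (\<forall>W\<in>\<D>. irreducible_subrep W) \<and> direct \<D>" for \<D>
  have bound: "card \<D> \<le> dim V" if "P \<D>" for \<D>
  proof -
    have "\<exists>w. w \<in> W \<and> w \<noteq> 0" if "W \<in> \<D>" for W
      using \<open>P \<D>\<close> that subrep_0[of W] by (auto simp: P_def irreducible_subrep_def)
    then obtain v where v: "\<And>W. W \<in> \<D> \<Longrightarrow> v W \<in> W" "\<And>W. W \<in> \<D> \<Longrightarrow> v W \<noteq> 0"
      by metis
    have D: "finite \<D>" "direct \<D>" "\<And>W. W \<in> \<D> \<Longrightarrow> subrep W"
      using \<open>P \<D>\<close> by (auto simp: P_def irreducible_subrep_def)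
    have "inj_on v \<D>" "independent (v ` \<D>)"
      using D v direct_independent[of \<D> v] by (auto dest: subrepD(1))
    moreover have "v ` \<D> \<subseteq> V"
      using v D(3) subrepD(2) by blast
    ultimately show ?thesis
      using independent_card_le_dim[OF assms(1,2) subset_refl, of "v ` \<D>"] by (simp add: card_image)
  qed
  have "P {}"
    by (simp add: P_def direct_def)
  then obtain \<D> where \<D>: "P \<D>" "\<And>\<D>'. P \<D>' \<Longrightarrow> card \<D>' \<le> card \<D>"
    using ex_has_greatest_nat[of P "{}" card "Suc (dim V)"] bound
    by (metis less_Suc_eq_le)
  have fin: "finite \<D>" and irr: "\<And>W. W \<in> \<D> \<Longrightarrow> irreducible_subrep W" and dir: "direct \<D>"
    using \<D>(1) by (auto simp: P_def)
  have sub: "subrep (span (\<Union>\<D>))"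
    using fin irr irreducible_subrep_imp_subrep by (intro subrep_span_Union) auto
  have "span (\<Union>\<D>) = V"
  proof (rule ccontr)
    assume "span (\<Union>\<D>) \<noteq> V"
    then obtain X where X: "subrep X" "X \<noteq> {0}" "X \<inter> span (\<Union>\<D>) = {0}"
      using compl[OF sub] by blast
    obtain W where W: "irreducible_subrep W" "W \<subseteq> X"
      using irreducible_subrep_exists[OF assms(1,2) X(1,2)] .
    have W0: "W \<inter> span (\<Union>\<D>) = {0}"
      using X(3) W span_zero subrep_0[OF irreducible_subrep_imp_subrep[OF W(1)]] by blast
    have "W \<notin> \<D>"
    proof
      assume "W \<in> \<D>"
      then have "W \<subseteq> span (\<Union>\<D>)"
        using span_superset by blast
      then show False
        using W0 W(1) by (auto simp: irreducible_subrep_def)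
    qed
    then have "P (insert W \<D>)"
      using W(1) fin irr dir direct_insert[OF fin dir _ _ W0] subrepD(1)[OF irreducible_subrep_imp_subrep[OF W(1)]]
      by (auto simp: P_def)
    then show False
      using \<D>(2) \<open>W \<notin> \<D>\<close> fin by fastforce
  qed
  then show ?thesis
    using fin irr dir by (auto simp: irreducible_decomposition_def direct_def)
qed

section \<open>Isomorphisms of subrepresentations and Schur's lemma\<close>

lemma subrep_isoI:
  assumes "bij_betw T U W"
    and "\<And>u v. u \<in> U \<Longrightarrow> v \<in> U \<Longrightarrow> T (u + v) = T u + T v"
    and "\<And>c u. u \<in> U \<Longrightarrow> T (scale c u) = scale c (T u)"
    and "\<And>g u. g \<in> carrier G \<Longrightarrow> u \<in> U \<Longrightarrow> T (\<rho> g u) = \<rho> g (T u)"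
  shows "subrep_iso U W"
  using assms unfolding subrep_iso_def by blast

lemma subrep_iso_sym:
  assumes "subrep U" "subrep_iso U W"
  shows "subrep_iso W U"
proof -
  obtain T where T: "bij_betw T U W"
    "\<And>u v. u \<in> U \<Longrightarrow> v \<in> U \<Longrightarrow> T (u + v) = T u + T v"
    "\<And>c u. u \<in> U \<Longrightarrow> T (scale c u) = scale c (T u)"
    "\<And>g u. g \<in> carrier G \<Longrightarrow> u \<in> U \<Longrightarrow> T (\<rho> g u) = \<rho> g (T u)"
    using assms(2) unfolding subrep_iso_def by blast
  let ?S = "inv_into U T"
  have S: "?S w \<in> U" "T (?S w) = w" if "w \<in> W" for w
    using that T(1) by (auto simp: bij_betw_def inv_into_into f_inv_into_f)
  have ST: "?S (T u) = u" if "u \<in> U" for u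
    using that T(1) by (simp add: bij_betw_def)
  show ?thesis
    unfolding subrep_iso_def
  proof (intro exI[of _ ?S] conjI ballI allI)
    show "bij_betw ?S W U"
      by (rule bij_betw_inv_into[OF T(1)])
  next
    fix u v assume "u \<in> W" "v \<in> W"
    then show "?S (u + v) = ?S u + ?S v"
      using S T(2)[of "?S u" "?S v"] ST[of "?S u + ?S v"] subspace_add[OF subrepD(1)[OF assms(1)]] by simp
  next
    fix c u assume "u \<in> W"
    then show "?S (scale c u) = scale c (?S u)"
      using S T(3)[of "?S u" c] ST[of "scale c (?S u)"] subspace_scale[OF subrepD(1)[OF assms(1)]] by simp
  next
    fix g u assume "g \<in> carrier G" "u \<in> W"
    then show "?S (\<rho> g u) = \<rho> g (?S u)"
      using S T(4)[of g "?S u"] ST[of "\<rho> g (?S u)"] subrepD(3)[OF assms(1)] by simp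
  qed
qed

text \<open>Schur's lemma, applied to the projections of an irreducible subrepresentation to the summands.\<close>

lemma irreducible_iso_summand:
  assumes D: "irreducible_decomposition \<D>" and W: "irreducible_subrep W"
  shows "\<exists>U\<in>\<D>. subrep_iso U W"
proof -
  note D' = irreducible_decompositionD[OF D]
  have sW: "subrep W"
    using W by (rule irreducible_subrep_imp_subrep)
  have "\<exists>f. (\<forall>U\<in>\<D>. f U \<in> U) \<and> v = (\<Sum>U\<in>\<D>. f U)" if "v \<in> W" for v
    using span_Union_subspaces[of \<D> v] D' subrepD(1,2) that sW by (metis subsetD)
  then obtain p where p: "\<And>v U. v \<in> W \<Longrightarrow> U \<in> \<D> \<Longrightarrow> p v U \<in> U"
    "\<And>v. v \<in> W \<Longrightarrow> v = (\<Sum>U\<in>\<D>. p v U)"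
    by metis
  \<comment> \<open>Directness makes the components of a vector unique. Additivity, homogeneity and
    equivariance of the projections all follow by comparing two decompositions of one
    vector.\<close>
  have unique: "p v U = f U"
    if "v \<in> W" "\<And>U. U \<in> \<D> \<Longrightarrow> f U \<in> U" "v = (\<Sum>U\<in>\<D>. f U)" "U \<in> \<D>" for v f U
  proof -
    have "p v U - f U = 0"
      using that p D'(3)
      by (intro directD[OF D'(5), where f = "\<lambda>U. p v U - f U"])
        (auto simp: subspace_diff subrepD(1) sum_subtractf)
    then show ?thesis by simp
  qed
  have p_add: "p (u + v) U = p u U + p v U" if "u \<in> W" "v \<in> W" "U \<in> \<D>" for u v U
  proof (rule unique)
    show "u + v = (\<Sum>U\<in>\<D>. p u U + p v U)"
      using p(2)[OF that(1)] p(2)[OF that(2)] by (simp add: sum.distrib)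
  qed (use that p(1) D'(3) sW in \<open>auto simp: subspace_add subrepD(1)\<close>)
  have p_scale: "p (scale c u) U = scale c (p u U)" if "u \<in> W" "U \<in> \<D>" for c u U
  proof (rule unique)
    show "scale c u = (\<Sum>U\<in>\<D>. scale c (p u U))"
      using p(2)[OF that(1)] by (simp flip: scale_sum_right)
  qed (use that p(1) D'(3) sW in \<open>auto simp: subspace_scale subrepD(1)\<close>)
  have p_rep: "p (\<rho> g u) U = \<rho> g (p u U)" if "g \<in> carrier G" "u \<in> W" "U \<in> \<D>" for g u U
  proof (rule unique)
    have "\<rho> g (\<Sum>U\<in>\<D>. p u U) = (\<Sum>U\<in>\<D>. \<rho> g (p u U))"
      using that p(1) D'(3) subrepD(2) by (intro rep_sum) blast+
    then show "\<rho> g u = (\<Sum>U\<in>\<D>. \<rho> g (p u U))"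
      using p(2)[OF that(2)] by simp
  qed (use that p(1) D'(3) sW in \<open>auto simp: subrepD(3)\<close>)
  obtain w where w: "w \<in> W" "w \<noteq> 0"
    using W subrep_0[OF sW] unfolding irreducible_subrep_def by blast
  obtain U where U: "U \<in> \<D>" "p w U \<noteq> 0"
  proof -
    have "\<exists>U\<in>\<D>. p w U \<noteq> 0"
      using p(2)[OF w(1)] w(2) by (metis sum.neutral)
    then show ?thesis using that by blast
  qed
  have sU: "subrep U"
    using D'(3) U(1) .
  define T where "T = (\<lambda>v. p v U)"
  have T: "\<And>v. v \<in> W \<Longrightarrow> T v \<in> U" "\<And>u v. u \<in> W \<Longrightarrow> v \<in> W \<Longrightarrow> T (u + v) = T u + T v"
    "\<And>c u. u \<in> W \<Longrightarrow> T (scale c u) = scale c (T u)"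
    "\<And>g u. g \<in> carrier G \<Longrightarrow> u \<in> W \<Longrightarrow> T (\<rho> g u) = \<rho> g (T u)"
    using p(1) p_add p_scale p_rep U(1) by (simp_all add: T_def)
  have T0: "T 0 = 0"
    using T(3)[OF w(1), of 0] by simp
  \<comment> \<open>The kernel is a subrepresentation of \<open>W\<close> that misses
    \<open>w\<close>, so irreducibility of \<open>W\<close> makes it zero. Likewise the image is
    non-zero, so irreducibility of \<open>U\<close> makes it all of \<open>U\<close>.\<close>
  have "subrep {v \<in> W. T v = 0}"
    unfolding subrep_def
  proof (intro conjI ballI)
    show "subspace {v \<in> W. T v = 0}"
      using subrepD(1)[OF sW] T(2,3) T0 unfolding subspace_def by simp
    show "{v \<in> W. T v = 0} \<subseteq> V"
      using subrepD(2)[OF sW] by blast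
    show "\<rho> g v \<in> {v \<in> W. T v = 0}" if "g \<in> carrier G" "v \<in> {v \<in> W. T v = 0}" for g v
      using that subrepD(3)[OF sW] T(4)[of g v] rep_zero by simp
  qed
  moreover have "{v \<in> W. T v = 0} \<noteq> W"
    using w U by (auto simp: T_def)
  ultimately have ker: "{v \<in> W. T v = 0} = {0}"
    using W unfolding irreducible_subrep_def by blast
  have "inj_on T W"
  proof (rule inj_onI)
    fix u v assume uv: "u \<in> W" "v \<in> W" "T u = T v"
    have "T (u + scale (-1) v) = 0"
      using uv T(2)[of u "scale (-1) v"] T(3)[of v "-1"] subspace_scale[OF subrepD(1)[OF sW], of v "-1"] by simp
    moreover have "u + scale (-1) v \<in> W"
      using uv subrepD(1)[OF sW] by (simp add: subspace_diff)
    ultimately have "u + scale (-1) v = 0"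
      using ker by blast
    then show "u = v" by simp
  qed
  moreover have "T ` W = U"
  proof -
    have "subrep (T ` W)"
      unfolding subrep_def subspace_def
    proof (intro conjI ballI allI)
      show "0 \<in> T ` W"
        using T0 subrep_0[OF sW] by (metis imageI)
      show "T ` W \<subseteq> V"
        using T(1) subrepD(2)[OF sU] by blast
      fix x assume "x \<in> T ` W"
      then obtain u where u: "u \<in> W" "x = T u" by blast
      show "scale c x \<in> T ` W" for c
        using u T(3)[of u c] subspace_scale[OF subrepD(1)[OF sW]] by (metis imageI)
      show "\<rho> g x \<in> T ` W" if "g \<in> carrier G" for g
        using u that T(4)[of g u] subrepD(3)[OF sW] by (metis imageI)
      fix y assume "y \<in> T ` W"
      then obtain v where "v \<in> W" "y = T v" by blast
      then show "x + y \<in> T ` W"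
        using u T(2)[of u v] subspace_add[OF subrepD(1)[OF sW]] by (metis imageI)
    qed
    moreover have "T ` W \<subseteq> U" "T ` W \<noteq> {0}"
      using T(1) U(2) w by (auto simp: T_def)
    ultimately show ?thesis
      using D'(2)[OF U(1)] unfolding irreducible_subrep_def by blast
  qed
  ultimately have "subrep_iso W U"
    using subrep_isoI[of T W U] T by (simp add: bij_betw_def)
  then show ?thesis
    using subrep_iso_sym[OF sW] U(1) by blast
qed

section \<open>The least degree and the least multiplicity\<close>

lemma min_degree_le:
  assumes "nontrivial_irreducible W"
  shows "min_degree \<le> dim W"
  unfolding min_degree_def using assms by (intro Least_le) blast

text \<open>Since some non-trivial irreducible exists, the least degree is attained. The finite
  spanning set excludes an infinite basis, whose cardinality would count as 0.\<close>

lemma min_degree_pos: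
  assumes "finite F" "V \<subseteq> span F" "nontrivial_irreducible W"
  shows "min_degree > 0"
proof -
  have "\<exists>W. nontrivial_irreducible W \<and> min_degree = dim W"
    unfolding min_degree_def by (rule LeastI_ex) (use assms(3) in blast)
  then obtain W where W: "nontrivial_irreducible W" "min_degree = dim W" by blast
  then have sW: "subrep W" and "W \<noteq> {0}"
    by (auto simp: nontrivial_irreducible_def irreducible_subrep_def)
  then obtain w where w: "w \<in> W" "w \<noteq> 0"
    using subrep_0 by blast
  then have "card {w} \<le> dim W"
    using independent_card_le_dim[OF assms(1,2) subrepD(2)[OF sW], of "{w}"] by simp
  then show ?thesis
    using W(2) by simp
qed

lemma min_multiplicity_le:
  assumes "nontrivial_irreducible W"
  shows "min_multiplicity \<le> multiplicity W"
  unfolding min_multiplicity_def using assms by (intro Least_le) blast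

text \<open>By Schur's lemma the decomposition selected in \<open>multiplicity\<close> has a summand
  isomorphic to any given irreducible.\<close>

lemma min_multiplicity_pos:
  assumes "\<exists>\<D>. irreducible_decomposition \<D>" "nontrivial_irreducible W"
  shows "min_multiplicity > 0"
proof -
  have "\<exists>W. nontrivial_irreducible W \<and> min_multiplicity = multiplicity W"
    unfolding min_multiplicity_def by (rule LeastI_ex) (use assms(2) in blast)
  then obtain W where W: "nontrivial_irreducible W" "min_multiplicity = multiplicity W" by blast
  define \<D> where "\<D> = (SOME \<D>. irreducible_decomposition \<D>)"
  have D: "irreducible_decomposition \<D>"
    unfolding \<D>_def using assms(1) by (rule someI_ex)
  have "{U \<in> \<D>. subrep_iso U W} \<noteq> {}"
    using irreducible_iso_summand[OF D, of W] W(1) by (auto simp: nontrivial_irreducible_def)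
  then show ?thesis
    using W(2) irreducible_decompositionD(1)[OF D] by (simp add: multiplicity_def card_gt_0_iff flip: \<D>_def)
qed

subsection \<open>Eigenspaces of elements of the group algebra\<close>

text \<open>The action of the group algebra element that is the sum of the \<open>h i\<close>. The
  index set lets group elements occur repeatedly, as the products \<open>inv s \<otimes> t\<close>
  do over all pairs.\<close>

definition alg_op :: "'i set \<Rightarrow> ('i \<Rightarrow> 'a) \<Rightarrow> 'v \<Rightarrow> 'v" where
  "alg_op I h v = (\<Sum>i\<in>I. \<rho> (h i) v)"

lemma alg_op_closed:
  assumes "\<And>i. i \<in> I \<Longrightarrow> h i \<in> carrier G" "subrep W" "v \<in> W"
  shows "alg_op I h v \<in> W"
  unfolding alg_op_def using assms by (intro subspace_sum) (auto simp: subrepD)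

lemma alg_op_sum:
  assumes "\<And>i. i \<in> I \<Longrightarrow> h i \<in> carrier G" "\<And>j. j \<in> J \<Longrightarrow> f j \<in> V"
  shows "alg_op I h (\<Sum>j\<in>J. f j) = (\<Sum>j\<in>J. alg_op I h (f j))"
  unfolding alg_op_def using assms by (subst sum.swap) (simp add: rep_sum)

lemma subspace_alg_op_eigen:
  assumes "\<And>i. i \<in> I \<Longrightarrow> h i \<in> carrier G"
  shows "subspace {u \<in> V. alg_op I h u = scale c u}"
  using assms subspace_V unfolding subspace_def
  by (auto simp: alg_op_def rep_add rep_zero rep_scale sum.distrib scale_right_distrib mult.commute
      simp flip: scale_sum_right)

text \<open>That \<open>g\<close> moves \<open>v\<close> forces some component of \<open>v\<close>
  to lie in a non-trivial summand. Isomorphisms copy this component into every summand of the same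
  type, and directness makes the copies independent.\<close>

lemma min_multiplicity_le_eigen:
  assumes ex: "\<exists>\<D>. irreducible_decomposition \<D>"
    and h: "\<And>i. i \<in> I \<Longrightarrow> h i \<in> carrier G"
    and v: "v \<in> V" "alg_op I h v = scale c v" and g: "g \<in> carrier G" "\<rho> g v \<noteq> v"
  obtains A where "finite A" "independent A" "A \<subseteq> {u \<in> V. alg_op I h u = scale c u}"
    "min_multiplicity \<le> card A"
proof -
  define \<D> where "\<D> = (SOME \<D>. irreducible_decomposition \<D>)"
  have D: "irreducible_decomposition \<D>"
    unfolding \<D>_def using ex by (rule someI_ex)
  note D' = irreducible_decompositionD[OF D]
  have sub: "\<And>W. W \<in> \<D> \<Longrightarrow> subspace W" "\<And>W. W \<in> \<D> \<Longrightarrow> W \<subseteq> V"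
    using D'(3) subrepD by auto
  obtain f where f: "\<And>W. W \<in> \<D> \<Longrightarrow> f W \<in> W" "v = (\<Sum>W\<in>\<D>. f W)"
    using span_Union_subspaces[of \<D> v] D'(1,4) sub v(1) by blast
  have fV: "\<And>W. W \<in> \<D> \<Longrightarrow> f W \<in> V"
    using f(1) sub(2) by blast
  \<comment> \<open>The operator maps each summand to itself, so the eigenvector equation can be
    compared component by component.\<close>
  have eig: "alg_op I h (f W) = scale c (f W)" if "W \<in> \<D>" for W
  proof -
    have "alg_op I h v = (\<Sum>W\<in>\<D>. alg_op I h (f W))"
      unfolding f(2) using h fV by (rule alg_op_sum)
    then have "(\<Sum>W\<in>\<D>. alg_op I h (f W) - scale c (f W)) = 0"
      using v(2) f(2) by (simp add: sum_subtractf flip: scale_sum_right)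
    then have "alg_op I h (f W) - scale c (f W) = 0"
      using that f(1) sub(1) D'(3) h
      by (intro directD[OF D'(5), where f = "\<lambda>W. alg_op I h (f W) - scale c (f W)"])
        (auto intro!: subspace_diff subspace_scale alg_op_closed)
    then show ?thesis by simp
  qed
  \<comment> \<open>If \<open>g\<close> fixed every component, it would fix
    \<open>v\<close>.\<close>
  obtain U where U: "U \<in> \<D>" "\<rho> g (f U) \<noteq> f U"
  proof -
    have "\<rho> g v = (\<Sum>W\<in>\<D>. \<rho> g (f W))"
      unfolding f(2) using g fV by (intro rep_sum) auto
    then have "\<exists>U\<in>\<D>. \<rho> g (f U) \<noteq> f U"
      using g(2) f(2) by (metis sum.cong)
    then show ?thesis using that by blast
  qed
  have fU0: "f U \<noteq> 0"
    using U(2) rep_zero[OF g(1)] by auto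
  have "nontrivial_irreducible U"
    using D'(2)[OF U(1)] U g(1) f(1) by (auto simp: nontrivial_irreducible_def trivial_subrep_def)
  then have min: "min_multiplicity \<le> multiplicity U"
    by (rule min_multiplicity_le)
  define \<E> where "\<E> = {W \<in> \<D>. subrep_iso W U}"
  \<comment> \<open>An equivariant linear bijection from \<open>U\<close> to \<open>W\<close>
    commutes with \<open>alg_op\<close>, so the image of \<open>f U\<close> is again an eigenvector
    for \<open>c\<close>.\<close>
  have "\<exists>u. u \<in> W \<and> u \<noteq> 0 \<and> alg_op I h u = scale c u" if W: "W \<in> \<E>" for W
  proof -
    have WD: "W \<in> \<D>"
      using W by (simp add: \<E>_def)
    have "subrep_iso U W"
      using W D'(3)[OF WD] subrep_iso_sym by (simp add: \<E>_def)
    then obtain T where T: "bij_betw T U W"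
      "\<And>u v. u \<in> U \<Longrightarrow> v \<in> U \<Longrightarrow> T (u + v) = T u + T v"
      "\<And>c u. u \<in> U \<Longrightarrow> T (scale c u) = scale c (T u)"
      "\<And>g u. g \<in> carrier G \<Longrightarrow> u \<in> U \<Longrightarrow> T (\<rho> g u) = \<rho> g (T u)"
      unfolding subrep_iso_def by blast
    have fU: "f U \<in> U"
      using f(1) U(1) .
    have zero: "0 \<in> U"
      using subrep_0 D'(3) U(1) by blast
    have T0: "T 0 = 0"
      using T(3)[OF zero, of 0] by simp
    have Tsum: "T (\<Sum>j\<in>J. k j) = (\<Sum>j\<in>J. T (k j))" if "\<And>j. j \<in> J \<Longrightarrow> k j \<in> U" for J :: "'i set" and k
      using that
    proof (induction J rule: infinite_finite_induct)
      case (insert j J)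
      then show ?case
        using T(2) subspace_sum[OF sub(1)[OF U(1)], of J k] by simp
    qed (use T0 in auto)
    have "alg_op I h (T (f U)) = (\<Sum>i\<in>I. T (\<rho> (h i) (f U)))"
      unfolding alg_op_def using T(4) h fU by (intro sum.cong) auto
    also have "\<dots> = T (alg_op I h (f U))"
      unfolding alg_op_def using h fU D'(3)[OF U(1)] by (intro Tsum[symmetric]) (auto simp: subrepD(3))
    also have "\<dots> = scale c (T (f U))"
      using eig[OF U(1)] T(3)[OF fU] by simp
    finally have "alg_op I h (T (f U)) = scale c (T (f U))" .
    moreover have "T (f U) \<in> W"
      using T(1) fU by (auto simp: bij_betw_def)
    moreover have "T (f U) \<noteq> 0"
      using inj_onD[OF bij_betw_imp_inj_on[OF T(1)] _ fU zero] fU0 T0 by auto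
    ultimately show ?thesis by blast
  qed
  then obtain e where e: "\<And>W. W \<in> \<E> \<Longrightarrow> e W \<in> W" "\<And>W. W \<in> \<E> \<Longrightarrow> e W \<noteq> 0"
    "\<And>W. W \<in> \<E> \<Longrightarrow> alg_op I h (e W) = scale c (e W)"
    by metis
  have sub\<E>: "\<E> \<subseteq> \<D>"
    by (auto simp: \<E>_def)
  have "finite \<E>"
    using D'(1) sub\<E> finite_subset by blast
  moreover have "direct \<E>"
    using direct_mono[OF D'(1,5) sub(1) sub\<E>] .
  ultimately have ind: "inj_on e \<E>" "independent (e ` \<E>)"
    using direct_independent[of \<E> e] e(1,2) sub(1) sub\<E> by auto
  have "finite (e ` \<E>)"
    using \<open>finite \<E>\<close> by simp
  moreover have "e ` \<E> \<subseteq> {u \<in> V. alg_op I h u = scale c u}"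
    using e(1,3) subsetD[OF sub(2)] subsetD[OF sub\<E>] by fastforce
  moreover have "min_multiplicity \<le> card (e ` \<E>)"
    using min ind(1) by (simp add: card_image multiplicity_def \<E>_def flip: \<D>_def)
  moreover note ind(2)
  ultimately show ?thesis
    using that by blast
qed

end

section \<open>Hermitian geometry of the function space\<close>

interpretation fs: vector_space fun_scale
  by (rule vector_space_fun_scale)

text \<open>Linear in the first argument and conjugate-linear in the second. Values outside \<Omega>
  are ignored, so the form is definite only on \<open>perm_space \<Omega>\<close>.\<close>

definition ip :: "'b set \<Rightarrow> ('b \<Rightarrow> complex) \<Rightarrow> ('b \<Rightarrow> complex) \<Rightarrow> complex" where
  "ip \<Omega> u v = (\<Sum>x\<in>\<Omega>. u x * cnj (v x))"

definition nsq :: "'b set \<Rightarrow> ('b \<Rightarrow> complex) \<Rightarrow> real" where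
  "nsq \<Omega> u = (\<Sum>x\<in>\<Omega>. (cmod (u x))\<^sup>2)"

lemma sum_fun_apply: "(\<Sum>i\<in>I. f i) x = (\<Sum>i\<in>I. f i x)"
  for f :: "'i \<Rightarrow> 'b \<Rightarrow> complex"
  by (induction I rule: infinite_finite_induct) auto

lemma ip_add_left: "ip \<Omega> (u + v) w = ip \<Omega> u w + ip \<Omega> v w"
  by (simp add: ip_def sum.distrib distrib_right)

lemma ip_diff_left: "ip \<Omega> (u - v) w = ip \<Omega> u w - ip \<Omega> v w"
  by (simp add: ip_def sum_subtractf left_diff_distrib)

lemma ip_scale_left: "ip \<Omega> (fun_scale c u) w = c * ip \<Omega> u w"
  by (simp add: ip_def fun_scale_def sum_distrib_left mult.assoc)

lemma ip_sum_left: "ip \<Omega> (\<Sum>i\<in>I. f i) w = (\<Sum>i\<in>I. ip \<Omega> (f i) w)"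
  unfolding ip_def sum_fun_apply sum_distrib_right by (rule sum.swap)

lemma ip_zero_left [simp]: "ip \<Omega> 0 w = 0"
  by (simp add: ip_def)

lemma cnj_ip: "cnj (ip \<Omega> u v) = ip \<Omega> v u"
  by (simp add: ip_def mult.commute)

lemma ip_add_right: "ip \<Omega> w (u + v) = ip \<Omega> w u + ip \<Omega> w v"
  by (simp add: ip_def sum.distrib distrib_left)

lemma ip_scale_right: "ip \<Omega> w (fun_scale c u) = cnj c * ip \<Omega> w u"
  by (simp add: ip_def fun_scale_def sum_distrib_left mult_ac)

lemma ip_sum_right: "ip \<Omega> w (\<Sum>i\<in>I. f i) = (\<Sum>i\<in>I. ip \<Omega> w (f i))"
  unfolding ip_def sum_fun_apply cnj_sum sum_distrib_left by (rule sum.swap)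

lemma cmod_ip_commute: "cmod (ip \<Omega> u v) = cmod (ip \<Omega> v u)"
  by (metis cnj_ip complex_mod_cnj)

lemma ip_self: "ip \<Omega> u u = complex_of_real (nsq \<Omega> u)"
  by (simp add: ip_def nsq_def complex_norm_square del: of_real_power)

lemma nsq_nonneg [simp]: "0 \<le> nsq \<Omega> u"
  by (simp add: nsq_def sum_nonneg)

lemma nsq_zero [simp]: "nsq \<Omega> 0 = 0"
  by (simp add: nsq_def)

lemma nsq_scale: "nsq \<Omega> (fun_scale c u) = (cmod c)\<^sup>2 * nsq \<Omega> u"
  by (simp add: nsq_def fun_scale_def sum_distrib_left norm_mult power_mult_distrib)

lemma nsq_eq_0_iff: "finite \<Omega> \<Longrightarrow> u \<in> perm_space \<Omega> \<Longrightarrow> nsq \<Omega> u = 0 \<longleftrightarrow> u = 0"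
  by (auto simp: nsq_def sum_nonneg_eq_0_iff perm_space_def fun_eq_iff)

lemma subspace_perm_space: "fs.subspace (perm_space \<Omega>)"
  by (auto simp: fs.subspace_def perm_space_def fun_scale_def)

text \<open>The indicator functions of points provide the finite spanning set that the general
  lemmas on representations ask for.\<close>

lemma perm_space_span:
  fixes \<Omega> :: "'b set"
  assumes "finite \<Omega>"
  shows "perm_space \<Omega> \<subseteq> fs.span ((\<lambda>x y. of_bool (y = x)) ` \<Omega>)"
proof
  fix f :: "'b \<Rightarrow> complex" assume f: "f \<in> perm_space \<Omega>"
  have "f = (\<Sum>x\<in>\<Omega>. fun_scale (f x) (\<lambda>y. of_bool (y = x)))"
  proof
    fix y
    have "(\<Sum>x\<in>\<Omega>. f x * of_bool (y = x)) = (if y \<in> \<Omega> then f y else 0)"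
      using assms by (simp add: of_bool_def if_distrib[of "\<lambda>z. _ * z"] sum.delta' cong: if_cong)
    then show "f y = (\<Sum>x\<in>\<Omega>. fun_scale (f x) (\<lambda>y. of_bool (y = x))) y"
      using f by (simp add: sum_fun_apply fun_scale_def perm_space_def)
  qed
  also have "\<dots> \<in> fs.span ((\<lambda>x y. of_bool (y = x)) ` \<Omega>)"
    by (intro fs.span_sum fs.span_scale fs.span_base) auto
  finally show "f \<in> fs.span ((\<lambda>x y. of_bool (y = x)) ` \<Omega>)" .
qed

subsection \<open>Orthonormal families\<close>

definition orthonormal :: "'b set \<Rightarrow> ('b \<Rightarrow> complex) set \<Rightarrow> bool" where
  "orthonormal \<Omega> E \<longleftrightarrow> (\<forall>u\<in>E. \<forall>v\<in>E. ip \<Omega> u v = (if u = v then 1 else 0))"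

definition proj :: "'b set \<Rightarrow> ('b \<Rightarrow> complex) set \<Rightarrow> ('b \<Rightarrow> complex) \<Rightarrow> 'b \<Rightarrow> complex" where
  "proj \<Omega> E v = (\<Sum>e\<in>E. fun_scale (ip \<Omega> v e) e)"

lemma proj_in_span: "proj \<Omega> E v \<in> fs.span E"
  unfolding proj_def by (intro fs.span_sum fs.span_scale fs.span_base)

lemma ip_proj:
  assumes "finite E" "orthonormal \<Omega> E" "e \<in> E"
  shows "ip \<Omega> (v - proj \<Omega> E v) e = 0"
proof -
  have "ip \<Omega> (proj \<Omega> E v) e = (\<Sum>e'\<in>E. ip \<Omega> v e' * (if e' = e then 1 else 0))"
    unfolding proj_def ip_sum_left ip_scale_left
    using assms by (intro sum.cong) (auto simp: orthonormal_def)
  also have "\<dots> = ip \<Omega> v e"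
    using assms(1,3) by (simp add: if_distrib[of "\<lambda>z. _ * z"] cong: if_cong)
  finally show ?thesis
    by (simp add: ip_diff_left)
qed

lemma ip_span_zero:
  assumes "\<And>e. e \<in> E \<Longrightarrow> ip \<Omega> r e = 0" "v \<in> fs.span E"
  shows "ip \<Omega> r v = 0"
proof -
  have "fs.subspace {v. ip \<Omega> r v = 0}"
    by (auto simp: fs.subspace_def ip_add_right ip_scale_right) (simp add: ip_def)
  then have "fs.span E \<subseteq> {v. ip \<Omega> r v = 0}"
    using assms(1) by (intro fs.span_minimal) auto
  then show ?thesis
    using assms(2) by blast
qed

text \<open>Pythagoras: \<open>v\<close> is its projection plus a remainder \<open>r\<close>
  orthogonal to the span of \<open>E\<close>, and \<open>nsq \<Omega> r\<close> is
  non-negative.\<close>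

lemma Bessel_inequality:
  assumes "finite E" "orthonormal \<Omega> E"
  shows "(\<Sum>e\<in>E. (cmod (ip \<Omega> v e))\<^sup>2) \<le> nsq \<Omega> v"
proof -
  define r where "r = v - proj \<Omega> E v"
  have r0: "ip \<Omega> r (proj \<Omega> E v) = 0"
    by (rule ip_span_zero[OF _ proj_in_span]) (use ip_proj assms in \<open>auto simp: r_def\<close>)
  have "ip \<Omega> r v = ip \<Omega> r (r + proj \<Omega> E v)"
    by (simp add: r_def)
  then have "ip \<Omega> r v = ip \<Omega> r r"
    by (simp only: ip_add_right r0 add_0_right)
  moreover have "ip \<Omega> (proj \<Omega> E v) v = (\<Sum>e\<in>E. complex_of_real ((cmod (ip \<Omega> v e))\<^sup>2))"
    unfolding proj_def ip_sum_left ip_scale_left complex_norm_square cnj_ip ..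
  moreover have "ip \<Omega> v v = ip \<Omega> r v + ip \<Omega> (proj \<Omega> E v) v"
    by (simp add: r_def ip_diff_left)
  ultimately have "complex_of_real (nsq \<Omega> v)
      = complex_of_real (nsq \<Omega> r + (\<Sum>e\<in>E. (cmod (ip \<Omega> v e))\<^sup>2))"
    by (simp add: ip_self)
  then have "nsq \<Omega> v = nsq \<Omega> r + (\<Sum>e\<in>E. (cmod (ip \<Omega> v e))\<^sup>2)"
    using of_real_eq_iff by blast
  then show ?thesis
    by simp
qed

text \<open>Each new vector loses its projection onto the earlier ones and is then normalised. Since
  the family lies in \<open>perm_space \<Omega>\<close>, a non-zero remainder has positive norm and
  can be normalised.\<close>

lemma Gram_Schmidt:
  assumes "finite \<Omega>" "finite A" "A \<subseteq> perm_space \<Omega>" "fs.independent A"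
  shows "\<exists>E. finite E \<and> card E = card A \<and> orthonormal \<Omega> E \<and> fs.span E = fs.span A"
  using assms(2-)
proof (induction A)
  case empty
  show ?case
    by (intro exI[of _ "{}"]) (simp add: orthonormal_def)
next
  case (insert a A)
  have indep: "fs.independent A" and a: "a \<notin> fs.span A"
    using insert.prems(2) insert.hyps(2) by (auto simp: fs.independent_insert)
  obtain E where E: "finite E" "card E = card A" "orthonormal \<Omega> E" "fs.span E = fs.span A"
    using insert.IH insert.prems(1) indep by auto
  define r where "r = a - proj \<Omega> E a"
  have p: "proj \<Omega> E a \<in> fs.span A"
    using proj_in_span E(4) by metis
  have "fs.span A \<subseteq> perm_space \<Omega>"
    using insert.prems(1) by (intro fs.span_minimal subspace_perm_space) auto
  then have "r \<in> perm_space \<Omega>"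
    unfolding r_def using insert.prems(1) p by (intro fs.subspace_diff subspace_perm_space) auto
  moreover have "r \<noteq> 0"
    using p a by (auto simp: r_def)
  ultimately have pos: "nsq \<Omega> r > 0"
    using nsq_eq_0_iff[OF assms(1)] nsq_nonneg[of \<Omega> r] by (metis less_eq_real_def)
  define k where "k = 1 / sqrt (nsq \<Omega> r)"
  define e where "e = fun_scale (of_real k) r"
  have k: "k > 0" "k\<^sup>2 * nsq \<Omega> r = 1"
    using pos by (auto simp: k_def power_divide)
  have orth: "ip \<Omega> e u = 0" if "u \<in> E" for u
    using ip_proj[OF E(1,3) that] by (simp add: e_def ip_scale_left r_def)
  have "nsq \<Omega> e = 1"
    using k by (simp add: e_def nsq_scale)
  then have unit: "ip \<Omega> e e = 1"
    by (simp add: ip_self)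
  have "e \<notin> E"
    using orth unit by fastforce
  have orth': "ip \<Omega> u e = 0" if "u \<in> E" for u
    using orth[OF that] cnj_ip[of \<Omega> e u] by simp
  have "orthonormal \<Omega> (insert e E)"
    using E(3) orth orth' unit \<open>e \<notin> E\<close> by (auto simp: orthonormal_def)
  moreover have "fs.span (insert e E) = fs.span (insert a A)"
  proof -
    have sub: "fs.span A \<subseteq> fs.span (insert a A)" "fs.span E \<subseteq> fs.span (insert e E)"
      by (intro fs.span_mono; blast)+
    have a': "a \<in> fs.span (insert a A)" and e': "e \<in> fs.span (insert e E)"
      by (auto intro: fs.span_base)
    have "e \<in> fs.span (insert a A)"
      unfolding e_def r_def using p sub a' by (intro fs.span_scale fs.span_diff) auto
    moreover have "E \<subseteq> fs.span (insert a A)"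
      using E(4) sub fs.span_superset by blast
    moreover have "a \<in> fs.span (insert e E)"
    proof -
      have "a = fun_scale (of_real (1 / k)) e + proj \<Omega> E a"
        using k(1) by (simp add: e_def r_def)
      also have "\<dots> \<in> fs.span (insert e E)"
        by (intro fs.span_add fs.span_scale e' subsetD[OF sub(2)] proj_in_span)
      finally show ?thesis .
    qed
    moreover have "A \<subseteq> fs.span (insert e E)"
      using E(4) sub fs.span_superset by blast
    ultimately show ?thesis
      unfolding fs.span_eq by blast
  qed
  ultimately show ?case
    using E(1,2) \<open>e \<notin> E\<close> insert.hyps by (intro exI[of _ "insert e E"]) simp
qed

text \<open>Subtract from a vector outside \<open>Y\<close> its projection onto an orthonormal basis
  of \<open>Y\<close>.\<close>

lemma orthogonal_vector_exists:
  assumes "finite \<Omega>" "fs.subspace Y" "Y \<subseteq> perm_space \<Omega>" "Y \<noteq> perm_space \<Omega>"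
  obtains u where "u \<in> perm_space \<Omega>" "u \<noteq> 0" "\<And>y. y \<in> Y \<Longrightarrow> ip \<Omega> u y = 0"
proof -
  obtain B where B: "B \<subseteq> Y" "fs.independent B" "Y \<subseteq> fs.span B"
    using fs.basis_exists[of Y] by metis
  have "finite B"
    using fs.independent_span_bound[OF finite_imageI[OF assms(1)] B(2)]
      perm_space_span[OF assms(1)] B(1) assms(3) by blast
  then obtain E where E: "finite E" "orthonormal \<Omega> E" "fs.span E = fs.span B"
    using Gram_Schmidt[OF assms(1), of B] B(1,2) assms(3) by blast
  have "fs.span B \<subseteq> Y"
    using B(1) assms(2) by (rule fs.span_minimal)
  then have Y: "fs.span E = Y"
    using B(3) E(3) by simp
  obtain v where v: "v \<in> perm_space \<Omega>" "v \<notin> Y"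
    using assms(3,4) by blast
  have p: "proj \<Omega> E v \<in> Y"
    using proj_in_span Y by blast
  show ?thesis
  proof
    show "v - proj \<Omega> E v \<in> perm_space \<Omega>"
      using v p assms(3) by (intro fs.subspace_diff subspace_perm_space) auto
    show "v - proj \<Omega> E v \<noteq> 0"
      using v p by auto
    show "ip \<Omega> (v - proj \<Omega> E v) y = 0" if "y \<in> Y" for y
      using ip_span_zero[of E \<Omega> "v - proj \<Omega> E v" y] ip_proj[OF E(1,2)] that Y by blast
  qed
qed

subsection \<open>The quadratic form of a finite family of functionals\<close>

text \<open>The common frame for both bounds: the \<open>b i\<close> are the translates of one
  vector in the bound by degree and the rows of the matrix of the operator in the bound by
  multiplicity.\<close>

definition qform :: "'b set \<Rightarrow> 'i set \<Rightarrow> ('i \<Rightarrow> 'b \<Rightarrow> complex) \<Rightarrow> ('b \<Rightarrow> complex) \<Rightarrow> real" where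
  "qform \<Omega> I b w = (\<Sum>i\<in>I. (cmod (ip \<Omega> w (b i)))\<^sup>2)"

lemma qform_nonneg [simp]: "0 \<le> qform \<Omega> I b w"
  by (simp add: qform_def sum_nonneg)

lemma qform_scale: "qform \<Omega> I b (fun_scale c w) = (cmod c)\<^sup>2 * qform \<Omega> I b w"
  by (simp add: qform_def ip_scale_left norm_mult power_mult_distrib sum_distrib_left)

text \<open>The right-hand side is the trace of the form, i.e. the squared Hilbert--Schmidt norm of \<open>b\<close>.\<close>

lemma card_independent_mult_le:
  fixes \<mu> :: real
  assumes "finite \<Omega>" "finite A" "A \<subseteq> perm_space \<Omega>" "fs.independent A"
    and "\<And>u. u \<in> fs.span A \<Longrightarrow> qform \<Omega> I b u = \<mu> * nsq \<Omega> u"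
  shows "card A * \<mu> \<le> (\<Sum>i\<in>I. nsq \<Omega> (b i))"
proof -
  obtain E where E: "finite E" "card E = card A" "orthonormal \<Omega> E" "fs.span E = fs.span A"
    using Gram_Schmidt[OF assms(1-4)] by blast
  have "nsq \<Omega> e = 1" if "e \<in> E" for e
    using E(3) that ip_self[of \<Omega> e] by (simp add: orthonormal_def)
  then have "card A * \<mu> = (\<Sum>e\<in>E. qform \<Omega> I b e)"
    using assms(5) E(2,4) fs.span_superset[of E] by (simp add: subset_iff)
  \<comment> \<open>After exchanging the sums, Bessel's inequality applies to each
    \<open>b i\<close> separately.\<close>
  also have "\<dots> = (\<Sum>i\<in>I. \<Sum>e\<in>E. (cmod (ip \<Omega> (b i) e))\<^sup>2)"
    unfolding qform_def by (subst sum.swap) (simp only: cmod_ip_commute)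
  also have "\<dots> \<le> (\<Sum>i\<in>I. nsq \<Omega> (b i))"
    by (intro sum_mono Bessel_inequality E)
  finally show ?thesis .
qed

text \<open>In the product topology the sphere is a closed subset of a product of unit discs over
  \<Omega> and points \<open>{0}\<close> elsewhere, which is compact by Tychonoff's theorem.\<close>

lemma compact_unit_sphere:
  fixes X :: "('b \<Rightarrow> complex) set"
  assumes "finite \<Omega>" "X \<subseteq> perm_space \<Omega>" "closed X"
  shows "compact {u \<in> X. nsq \<Omega> u = 1}"
proof -
  define K :: "('b \<Rightarrow> complex) set" where "K = PiE UNIV (\<lambda>x. if x \<in> \<Omega> then cball 0 1 else {0})"
  have "compactin (product_topology (\<lambda>i. euclidean) UNIV) K"
    unfolding K_def compactin_PiE by simp
  then have K: "compact K"
    by (simp add: euclidean_product_topology)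
  have "closed {u. nsq \<Omega> u = 1}"
    unfolding nsq_def by (intro closed_Collect_eq continuous_intros continuous_on_product_coordinates)
  then have "compact (K \<inter> (X \<inter> {u. nsq \<Omega> u = 1}))"
    using K assms(3) by (intro compact_Int_closed closed_Int)
  moreover have "{u \<in> X. nsq \<Omega> u = 1} \<subseteq> K"
  proof
    fix u assume u: "u \<in> {u \<in> X. nsq \<Omega> u = 1}"
    have "cmod (u x) \<le> 1" if "x \<in> \<Omega>" for x
    proof -
      have "(cmod (u x))\<^sup>2 \<le> nsq \<Omega> u"
        unfolding nsq_def using that assms(1) by (intro member_le_sum) auto
      then show ?thesis
        using u by (simp add: power_le_one_iff abs_square_le_1)
    qed
    then show "u \<in> K"
      using u assms(2) by (auto simp: K_def perm_space_def)
  qed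
  then have "K \<inter> (X \<inter> {u. nsq \<Omega> u = 1}) = {u \<in> X. nsq \<Omega> u = 1}"
    by blast
  ultimately show ?thesis
    by simp
qed

text \<open>By compactness the form attains its maximum \<mu> on the unit sphere of
  \<open>X\<close>; both sides are homogeneous of degree two, so the bound passes to all of
  \<open>X\<close>.\<close>

lemma qform_maximum:
  fixes X :: "('b \<Rightarrow> complex) set"
  assumes "finite \<Omega>" "X \<subseteq> perm_space \<Omega>" "closed X" "fs.subspace X" "X \<noteq> {0}"
  obtains \<mu> u where "\<mu> \<ge> 0" "u \<in> X" "u \<noteq> 0" "qform \<Omega> I b u = \<mu> * nsq \<Omega> u"
    "\<And>w. w \<in> X \<Longrightarrow> qform \<Omega> I b w \<le> \<mu> * nsq \<Omega> w"
proof -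
  have normalise: "\<exists>c. c \<noteq> 0 \<and> fun_scale c w \<in> {u \<in> X. nsq \<Omega> u = 1} \<and> (cmod c)\<^sup>2 * nsq \<Omega> w = 1"
    if w: "w \<in> X" "w \<noteq> 0" for w
  proof -
    have pos: "nsq \<Omega> w > 0"
      using nsq_eq_0_iff[OF assms(1), of w] nsq_nonneg[of \<Omega> w] w assms(2) by (metis less_eq_real_def subsetD)
    then have "(cmod (of_real (1 / sqrt (nsq \<Omega> w))))\<^sup>2 * nsq \<Omega> w = 1"
      by (simp add: power_divide norm_divide)
    then show ?thesis
      using pos w assms(4)
      by (intro exI[of _ "of_real (1 / sqrt (nsq \<Omega> w))"]) (simp add: nsq_scale fs.subspace_scale)
  qed
  have "\<exists>w\<in>X. w \<noteq> 0"
    using assms(4,5) fs.subspace_0 by blast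
  then have ne: "{u \<in> X. nsq \<Omega> u = 1} \<noteq> {}"
    using normalise by blast
  have "continuous_on {u \<in> X. nsq \<Omega> u = 1} (qform \<Omega> I b)"
    unfolding qform_def ip_def
    by (intro continuous_intros continuous_on_subset[OF continuous_on_product_coordinates]) auto
  then obtain u where u: "u \<in> X" "nsq \<Omega> u = 1"
    "\<And>w. w \<in> X \<Longrightarrow> nsq \<Omega> w = 1 \<Longrightarrow> qform \<Omega> I b w \<le> qform \<Omega> I b u"
    using continuous_attains_sup[OF compact_unit_sphere[OF assms(1-3)] ne] by blast
  show ?thesis
  proof
    show "u \<in> X" "u \<noteq> 0" "qform \<Omega> I b u = qform \<Omega> I b u * nsq \<Omega> u" "qform \<Omega> I b u \<ge> 0"
      using u by auto
    fix w assume w: "w \<in> X"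
    show "qform \<Omega> I b w \<le> qform \<Omega> I b u * nsq \<Omega> w"
    proof (cases "w = 0")
      case True
      then show ?thesis by (simp add: qform_def)
    next
      case False
      obtain c where c: "c \<noteq> 0" "fun_scale c w \<in> {u \<in> X. nsq \<Omega> u = 1}" "(cmod c)\<^sup>2 * nsq \<Omega> w = 1"
        using normalise[OF w False] by blast
      have "(cmod c)\<^sup>2 * qform \<Omega> I b w \<le> qform \<Omega> I b u"
        using u(3) c(2) by (simp flip: qform_scale)
      also have "\<dots> = (cmod c)\<^sup>2 * (qform \<Omega> I b u * nsq \<Omega> w)"
        using c(3) by (simp add: mult.left_commute)
      finally show ?thesis
        using c(1) by (simp add: mult_le_cancel_left_pos)
    qed
  qed
qed

text \<open>The cross term is the sesquilinear form that polarises \<open>qform\<close>. With the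
  analogous expansion of \<open>nsq\<close> it drives the variational argument below.\<close>

lemma qform_add_scale:
  "qform \<Omega> I b (u + fun_scale t w) = qform \<Omega> I b u
     + 2 * Re (cnj t * (\<Sum>i\<in>I. ip \<Omega> u (b i) * cnj (ip \<Omega> w (b i)))) + (cmod t)\<^sup>2 * qform \<Omega> I b w"
proof -
  have "(cmod (ip \<Omega> (u + fun_scale t w) (b i)))\<^sup>2 = (cmod (ip \<Omega> u (b i)))\<^sup>2
     + 2 * Re (cnj t * (ip \<Omega> u (b i) * cnj (ip \<Omega> w (b i)))) + (cmod t)\<^sup>2 * (cmod (ip \<Omega> w (b i)))\<^sup>2" for i
    by (simp add: ip_add_left ip_scale_left cmod_power2) (simp add: algebra_simps power2_eq_square)
  then show ?thesis
    by (simp add: qform_def sum.distrib sum_distrib_left)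
qed

lemma nsq_add_scale:
  "nsq \<Omega> (u + fun_scale t w) = nsq \<Omega> u + 2 * Re (cnj t * ip \<Omega> u w) + (cmod t)\<^sup>2 * nsq \<Omega> w"
proof -
  have "(cmod (u x + t * w x))\<^sup>2 = (cmod (u x))\<^sup>2
     + 2 * Re (cnj t * (u x * cnj (w x))) + (cmod t)\<^sup>2 * (cmod (w x))\<^sup>2" for x
    by (simp add: cmod_power2) (simp add: algebra_simps power2_eq_square)
  then show ?thesis
    by (simp add: nsq_def ip_def fun_scale_def sum.distrib sum_distrib_left)
qed

text \<open>Maximisers are the eigenvectors for the top eigenvalue \<mu>, here in weak form, tested
  against all \<open>w\<close> in \<open>X\<close>. This turns a quadratic condition on
  \<open>u\<close> into a linear one.\<close>

lemma qform_maximiser_iff: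
  assumes "fs.subspace X" "\<And>w. w \<in> X \<Longrightarrow> qform \<Omega> I b w \<le> \<mu> * nsq \<Omega> w" "u \<in> X"
  shows "qform \<Omega> I b u = \<mu> * nsq \<Omega> u \<longleftrightarrow>
    (\<forall>w\<in>X. (\<Sum>i\<in>I. ip \<Omega> u (b i) * cnj (ip \<Omega> w (b i))) = of_real \<mu> * ip \<Omega> u w)"
proof
  assume "\<forall>w\<in>X. (\<Sum>i\<in>I. ip \<Omega> u (b i) * cnj (ip \<Omega> w (b i))) = of_real \<mu> * ip \<Omega> u w"
  then have "complex_of_real (qform \<Omega> I b u) = of_real (\<mu> * nsq \<Omega> u)"
    using assms(3) by (simp add: qform_def complex_norm_square ip_self del: of_real_power)
  then show "qform \<Omega> I b u = \<mu> * nsq \<Omega> u"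
    using of_real_eq_iff by blast
next
  assume eq: "qform \<Omega> I b u = \<mu> * nsq \<Omega> u"
  show "\<forall>w\<in>X. (\<Sum>i\<in>I. ip \<Omega> u (b i) * cnj (ip \<Omega> w (b i))) = of_real \<mu> * ip \<Omega> u w"
  proof
    fix w assume w: "w \<in> X"
    \<comment> \<open>\<beta> is the defect in the eigenvalue equation and \<gamma> the slack of the
      inequality at \<open>w\<close>. Moving from \<open>u\<close> to \<open>u + t w\<close>
      compares the first-order gain from \<beta> with the second-order loss from \<gamma>.\<close>
    define \<beta> where "\<beta> = (\<Sum>i\<in>I. ip \<Omega> u (b i) * cnj (ip \<Omega> w (b i))) - of_real \<mu> * ip \<Omega> u w"
    define \<gamma> where "\<gamma> = \<mu> * nsq \<Omega> w - qform \<Omega> I b w"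
    have \<gamma>: "\<gamma> \<ge> 0"
      using assms(2)[OF w] by (simp add: \<gamma>_def)
    have le: "2 * Re (cnj t * \<beta>) \<le> (cmod t)\<^sup>2 * \<gamma>" for t
    proof -
      have "u + fun_scale t w \<in> X"
        using assms(1,3) w by (intro fs.subspace_add fs.subspace_scale)
      then have "qform \<Omega> I b (u + fun_scale t w) \<le> \<mu> * nsq \<Omega> (u + fun_scale t w)"
        by (rule assms(2))
      then have "2 * Re (cnj t * (\<Sum>i\<in>I. ip \<Omega> u (b i) * cnj (ip \<Omega> w (b i)))) + (cmod t)\<^sup>2 * qform \<Omega> I b w
         \<le> \<mu> * (2 * Re (cnj t * ip \<Omega> u w)) + \<mu> * ((cmod t)\<^sup>2 * nsq \<Omega> w)"
        unfolding qform_add_scale nsq_add_scale using eq by (simp add: distrib_left)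
      moreover have "Re (cnj t * \<beta>) = Re (cnj t * (\<Sum>i\<in>I. ip \<Omega> u (b i) * cnj (ip \<Omega> w (b i))))
          - \<mu> * Re (cnj t * ip \<Omega> u w)"
        by (simp add: \<beta>_def algebra_simps)
      ultimately show ?thesis
        by (simp add: \<gamma>_def algebra_simps)
    qed
    \<comment> \<open>With \<open>t = \<epsilon> \<beta>\<close> the gain is linear in \<epsilon>
      and the loss quadratic; \<open>\<epsilon> \<gamma> < 1\<close> makes the gain win unless
      \<beta> vanishes.\<close>
    define \<epsilon> where "\<epsilon> = 1 / (\<gamma> + 1)"
    have \<epsilon>: "\<epsilon> > 0" "\<epsilon> * \<gamma> < 1"
      using \<gamma> by (auto simp: \<epsilon>_def)
    have "Re (cnj (of_real \<epsilon> * \<beta>) * \<beta>) = \<epsilon> * (cmod \<beta>)\<^sup>2"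
      by (simp add: cmod_power2) (simp add: power2_eq_square algebra_simps)
    moreover have "(cmod (of_real \<epsilon> * \<beta>))\<^sup>2 = \<epsilon>\<^sup>2 * (cmod \<beta>)\<^sup>2"
      by (simp add: norm_mult power_mult_distrib)
    ultimately have "\<epsilon> * (2 * (cmod \<beta>)\<^sup>2) \<le> \<epsilon> * (\<epsilon> * \<gamma> * (cmod \<beta>)\<^sup>2)"
      using le[of "of_real \<epsilon> * \<beta>"] by (simp add: power2_eq_square mult_ac)
    then have "2 * (cmod \<beta>)\<^sup>2 \<le> \<epsilon> * \<gamma> * (cmod \<beta>)\<^sup>2"
      using \<epsilon>(1) by (simp add: mult_le_cancel_left_pos)
    also have "\<dots> \<le> 1 * (cmod \<beta>)\<^sup>2"
      using \<epsilon>(2) by (intro mult_right_mono) auto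
    finally have "\<beta> = 0"
      by simp
    then show "(\<Sum>i\<in>I. ip \<Omega> u (b i) * cnj (ip \<Omega> w (b i))) = of_real \<mu> * ip \<Omega> u w"
      by (simp add: \<beta>_def)
  qed
qed

lemma subspace_qform_maximisers:
  assumes "fs.subspace X" "\<And>w. w \<in> X \<Longrightarrow> qform \<Omega> I b w \<le> \<mu> * nsq \<Omega> w"
  shows "fs.subspace {u \<in> X. qform \<Omega> I b u = \<mu> * nsq \<Omega> u}"
proof -
  have "{u \<in> X. qform \<Omega> I b u = \<mu> * nsq \<Omega> u} = {u \<in> X.
    \<forall>w\<in>X. (\<Sum>i\<in>I. ip \<Omega> u (b i) * cnj (ip \<Omega> w (b i))) = of_real \<mu> * ip \<Omega> u w}"
    using qform_maximiser_iff[OF assms] by blast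
  moreover have "fs.subspace \<dots>"
    using assms(1) unfolding fs.subspace_def
    by (auto simp: ip_add_left ip_scale_left distrib_right distrib_left sum.distrib mult.assoc
        mult.left_commute[of _ "of_real \<mu>"] simp flip: sum_distrib_left)
  ultimately show ?thesis
    by simp
qed

subsection \<open>Functions with sum zero\<close>

text \<open>The orthogonal complement of the constant functions on \<Omega> within
  \<open>perm_space \<Omega>\<close>.\<close>

definition zero_sum :: "'b set \<Rightarrow> ('b \<Rightarrow> complex) set" where
  "zero_sum \<Omega> = {f \<in> perm_space \<Omega>. (\<Sum>x\<in>\<Omega>. f x) = 0}"

lemma zero_sum_subset: "zero_sum \<Omega> \<subseteq> perm_space \<Omega>"
  by (auto simp: zero_sum_def)

lemma subspace_zero_sum: "fs.subspace (zero_sum \<Omega>)"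
  using subspace_perm_space[of \<Omega>] unfolding fs.subspace_def
  by (auto simp: zero_sum_def fun_scale_def sum.distrib simp flip: sum_distrib_left)

lemma closed_zero_sum: "closed (zero_sum \<Omega>)"
proof -
  have "zero_sum \<Omega> = (\<Inter>x\<in>-\<Omega>. {f. f x = 0}) \<inter> {f. (\<Sum>x\<in>\<Omega>. f x) = 0}"
    by (auto simp: zero_sum_def perm_space_def)
  moreover have "closed \<dots>"
    by (intro closed_Int closed_INT ballI closed_Collect_eq continuous_intros continuous_on_product_coordinates)
  ultimately show ?thesis
    by simp
qed

text \<open>The difference of the indicators of two distinct points.\<close>

lemma zero_sum_nontrivial:
  fixes \<Omega> :: "'b set"
  assumes "finite \<Omega>" "card \<Omega> \<ge> 2"
  shows "zero_sum \<Omega> \<noteq> {0}"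
proof -
  obtain x y where xy: "x \<in> \<Omega>" "y \<in> \<Omega>" "x \<noteq> y"
    using card_le_Suc0_iff_eq[OF assms(1)] assms(2) by fastforce
  define f :: "'b \<Rightarrow> complex" where "f = (\<lambda>z. if z = x then 1 else if z = y then -1 else 0)"
  have "(\<Sum>z\<in>\<Omega>. f z) = (\<Sum>z\<in>{x, y}. f z)"
    using xy assms(1) by (intro sum.mono_neutral_right) (auto simp: f_def)
  then have "f \<in> zero_sum \<Omega>"
    using xy by (auto simp: zero_sum_def perm_space_def f_def)
  moreover have "f \<noteq> 0"
    by (metis f_def zero_fun_apply zero_neq_one)
  ultimately show ?thesis
    by blast
qed

section \<open>The permutation representation of a finite transitive action\<close>

locale finite_transitive_action = transitive_action G \<Omega> \<phi>
  for G (structure) and \<Omega> :: "'b set" and \<phi> +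
  assumes finite_carrier: "finite (carrier G)"
    and finite_space: "finite \<Omega>"
    and card_space: "2 \<le> card \<Omega>"
begin

abbreviation \<rho> :: "'a \<Rightarrow> ('b \<Rightarrow> complex) \<Rightarrow> 'b \<Rightarrow> complex" where
  "\<rho> \<equiv> perm_rep G \<Omega> \<phi>"

sublocale rep: complex_representation G fun_scale "perm_space \<Omega>" \<rho>
  by (rule complex_representation_perm_rep[OF group_action_axioms])

lemma act_closed: "g \<in> carrier G \<Longrightarrow> x \<in> \<Omega> \<Longrightarrow> \<phi> g x \<in> \<Omega>"
  using element_image by blast

lemma act_inv_act: "g \<in> carrier G \<Longrightarrow> x \<in> \<Omega> \<Longrightarrow> \<phi> (inv g) (\<phi> g x) = x"
  using orbit_sym_aux by blast

lemma act_act_inv: "g \<in> carrier G \<Longrightarrow> x \<in> \<Omega> \<Longrightarrow> \<phi> g (\<phi> (inv g) x) = x"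
  using act_inv_act[of "inv g" x] by simp

lemma bij_act: "g \<in> carrier G \<Longrightarrow> bij_betw (\<phi> g) \<Omega> \<Omega>"
  using bij_prop0 by (simp add: Bij_def)

lemma rep_apply: "x \<in> \<Omega> \<Longrightarrow> \<rho> g f x = f (\<phi> (inv g) x)"
  by (simp add: perm_rep_def)

text \<open>Group elements permute \<Omega>, so the representation is unitary.\<close>

lemma ip_rep:
  assumes "g \<in> carrier G"
  shows "ip \<Omega> (\<rho> g u) (\<rho> g v) = ip \<Omega> u v"
proof -
  have "ip \<Omega> (\<rho> g u) (\<rho> g v) = (\<Sum>x\<in>\<Omega>. u (\<phi> (inv g) x) * cnj (v (\<phi> (inv g) x)))"
    unfolding ip_def by (intro sum.cong) (auto simp: rep_apply)
  also have "\<dots> = ip \<Omega> u v"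
    unfolding ip_def using bij_act[of "inv g"] assms
    by (intro sum.reindex_bij_betw[where g = "\<lambda>x. u x * cnj (v x)"]) simp
  finally show ?thesis .
qed

lemma nsq_rep:
  assumes "g \<in> carrier G"
  shows "nsq \<Omega> (\<rho> g u) = nsq \<Omega> u"
  using ip_rep[OF assms, of u u] of_real_eq_iff by (metis ip_self)

lemma ip_rep_inv:
  assumes "g \<in> carrier G" "v \<in> perm_space \<Omega>"
  shows "ip \<Omega> (\<rho> (inv g) u) v = ip \<Omega> u (\<rho> g v)"
proof -
  have "\<rho> (inv g) (\<rho> g v) = v"
    using rep.rep_mult[of "inv g" g v] rep.rep_one[of v] assms by simp
  then show ?thesis
    using ip_rep[of "inv g" u "\<rho> g v"] assms(1) by simp
qed

section \<open>The zero-sum subrepresentation and complete reducibility\<close>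

lemma rep_zero_sum:
  assumes "g \<in> carrier G" "f \<in> zero_sum \<Omega>"
  shows "\<rho> g f \<in> zero_sum \<Omega>"
proof -
  have "(\<Sum>x\<in>\<Omega>. \<rho> g f x) = (\<Sum>x\<in>\<Omega>. f (\<phi> (inv g) x))"
    by (intro sum.cong) (auto simp: rep_apply)
  also have "\<dots> = (\<Sum>x\<in>\<Omega>. f x)"
    using bij_act[of "inv g"] assms(1) by (intro sum.reindex_bij_betw) simp
  finally show ?thesis
    using assms rep.rep_closed by (auto simp: zero_sum_def)
qed

lemma subrep_zero_sum: "rep.subrep (zero_sum \<Omega>)"
  by (simp add: rep.subrep_def subspace_zero_sum zero_sum_subset rep_zero_sum)

text \<open>By transitivity an invariant function is constant on \<Omega>, and a constant with sum
  zero vanishes.\<close>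

lemma fixed_zero_sum:
  assumes "f \<in> zero_sum \<Omega>" "\<And>g. g \<in> carrier G \<Longrightarrow> \<rho> g f = f"
  shows "f = 0"
proof -
  have const: "f x = f y" if xy: "x \<in> \<Omega>" "y \<in> \<Omega>" for x y
  proof -
    obtain g where g: "g \<in> carrier G" "\<phi> g x = y"
      using unique_orbit[OF xy] by blast
    have "f y = \<rho> g f y"
      using assms(2)[OF g(1)] by simp
    also have "\<dots> = f x"
      using g act_inv_act[OF g(1) xy(1)] xy by (simp add: rep_apply)
    finally show ?thesis by simp
  qed
  have "f x = 0" for x
  proof (cases "x \<in> \<Omega>")
    case True
    then have "(\<Sum>y\<in>\<Omega>. f y) = (\<Sum>y\<in>\<Omega>. f x)"
      by (intro sum.cong refl const)
    then show ?thesis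
      using assms(1) card_space by (simp add: zero_sum_def)
  next
    case False
    then show ?thesis
      using assms(1) by (simp add: zero_sum_def perm_space_def)
  qed
  then show ?thesis
    by (intro ext) simp
qed

lemma nontrivial_irreducible_zero_sum:
  assumes "rep.irreducible_subrep W" "W \<subseteq> zero_sum \<Omega>"
  shows "rep.nontrivial_irreducible W"
proof -
  have "\<not> rep.trivial_subrep W"
  proof
    assume triv: "rep.trivial_subrep W"
    have "w = 0" if "w \<in> W" for w
      using fixed_zero_sum[of w] that assms(2) triv by (auto simp: rep.trivial_subrep_def)
    then have "W = {0}"
      using rep.subrep_0 assms(1) by (auto simp: rep.irreducible_subrep_def)
    then show False
      using assms(1) by (simp add: rep.irreducible_subrep_def)
  qed
  then show ?thesis
    using assms(1) by (simp add: rep.nontrivial_irreducible_def)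
qed

lemmas span_perm_space = finite_imageI[OF finite_space] perm_space_span[OF finite_space]

lemma nontrivial_irreducible_exists:
  assumes "rep.subrep X" "X \<noteq> {0}" "X \<subseteq> zero_sum \<Omega>"
  obtains W where "rep.nontrivial_irreducible W" "W \<subseteq> X"
  using rep.irreducible_subrep_exists[OF span_perm_space assms(1,2)] nontrivial_irreducible_zero_sum assms(3)
  by (metis subset_trans)

lemma nontrivial_irreducible_ex: "\<exists>W. rep.nontrivial_irreducible W"
  using nontrivial_irreducible_exists[OF subrep_zero_sum zero_sum_nontrivial[OF finite_space card_space]]
  by blast

lemma min_degree_pos: "rep.min_degree > 0"
  using rep.min_degree_pos[OF span_perm_space] nontrivial_irreducible_ex by blast

text \<open>By unitarity the orthogonal complement of a subrepresentation is again a
  subrepresentation; it meets \<open>Y\<close> only in 0 because the form is definite on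
  \<open>perm_space \<Omega>\<close>.\<close>

lemma decomposition_exists: "\<exists>\<D>. rep.irreducible_decomposition \<D>"
proof (rule rep.irreducible_decomposition_exists[OF span_perm_space])
  fix Y assume Y: "rep.subrep Y" "Y \<noteq> perm_space \<Omega>"
  define X where "X = {u \<in> perm_space \<Omega>. \<forall>y\<in>Y. ip \<Omega> u y = 0}"
  obtain u where "u \<in> perm_space \<Omega>" "u \<noteq> 0" "\<And>y. y \<in> Y \<Longrightarrow> ip \<Omega> u y = 0"
    using orthogonal_vector_exists[OF finite_space rep.subrepD(1,2)[OF Y(1)] Y(2)] by metis
  then have "u \<in> X" "u \<noteq> 0"
    by (auto simp: X_def)
  then have "X \<noteq> {0}"
    by blast
  moreover have "rep.subrep X"
    unfolding rep.subrep_def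
  proof (intro conjI ballI)
    show "fs.subspace X"
      using subspace_perm_space[of \<Omega>] unfolding fs.subspace_def X_def
      by (simp add: ip_add_left ip_scale_left)
    show "X \<subseteq> perm_space \<Omega>"
      by (auto simp: X_def)
    fix g u assume g: "g \<in> carrier G" and u: "u \<in> X"
    have "ip \<Omega> (\<rho> g u) y = 0" if "y \<in> Y" for y
      using ip_rep_inv[of "inv g" y u] that g u rep.subrepD(2,3)[OF Y(1)] by (auto simp: X_def)
    then show "\<rho> g u \<in> X"
      using g u rep.rep_closed by (simp add: X_def)
  qed
  moreover have "X \<inter> Y = {0}"
  proof -
    have "u = 0" if "u \<in> X" "u \<in> Y" for u
    proof -
      have "ip \<Omega> u u = 0" "u \<in> perm_space \<Omega>"
        using that by (auto simp: X_def)
      then show ?thesis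
        using nsq_eq_0_iff[OF finite_space] by (simp add: ip_self)
    qed
    moreover have "0 \<in> X" "0 \<in> Y"
      using rep.subrep_0 Y(1) \<open>rep.subrep X\<close> by blast+
    ultimately show ?thesis
      by blast
  qed
  ultimately show "\<exists>X. rep.subrep X \<and> X \<noteq> {0} \<and> X \<inter> Y = {0}"
    by blast
qed

lemma min_multiplicity_pos: "rep.min_multiplicity > 0"
  using rep.min_multiplicity_pos[OF decomposition_exists] nontrivial_irreducible_ex by blast

subsection \<open>The bound in terms of the degree\<close>

text \<open>Moving \<open>h\<close> to the other side replaces \<open>g\<close> by
  \<open>inv h \<otimes> g\<close>, which only permutes the summands.\<close>

lemma qform_orbit_invariant:
  assumes h: "h \<in> carrier G" and w: "w \<in> perm_space \<Omega>" and v: "v \<in> perm_space \<Omega>"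
  shows "qform \<Omega> (carrier G) (\<lambda>g. \<rho> g v) (\<rho> h w) = qform \<Omega> (carrier G) (\<lambda>g. \<rho> g v) w"
proof -
  have "ip \<Omega> (\<rho> h w) (\<rho> g v) = ip \<Omega> w (\<rho> (inv h \<otimes> g) v)" if "g \<in> carrier G" for g
    using ip_rep_inv[of "inv h" "\<rho> g v" w] rep.rep_mult[of "inv h" g v] rep.rep_closed[OF that v] that h v by simp
  then have "qform \<Omega> (carrier G) (\<lambda>g. \<rho> g v) (\<rho> h w)
      = (\<Sum>g\<in>carrier G. (cmod (ip \<Omega> w (\<rho> (inv h \<otimes> g) v)))\<^sup>2)"
    unfolding qform_def by (intro sum.cong) auto
  also have "bij_betw (\<lambda>g. inv h \<otimes> g) (carrier G) (carrier G)"
    using h by (intro bij_betw_byWitness[where f' = "\<lambda>g. h \<otimes> g"]) (auto simp flip: rep.m_assoc)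
  then have "(\<Sum>g\<in>carrier G. (cmod (ip \<Omega> w (\<rho> (inv h \<otimes> g) v)))\<^sup>2) = qform \<Omega> (carrier G) (\<lambda>g. \<rho> g v) w"
    unfolding qform_def by (rule sum.reindex_bij_betw)
  finally show ?thesis .
qed

text \<open>
  A substitute for the Schur orthogonality relations: the maximisers of the form form a
  subrepresentation of dimension at least the minimum degree, while the trace of the form is
  \<open>|G| \<parallel>v\<parallel>\<^sup>2\<close>.
\<close>

lemma qform_orbit_le:
  assumes v: "v \<in> perm_space \<Omega>" and w: "w \<in> zero_sum \<Omega>"
  shows "qform \<Omega> (carrier G) (\<lambda>g. \<rho> g v) w \<le> order G / rep.min_degree * nsq \<Omega> v * nsq \<Omega> w"
proof -
  let ?Q = "qform \<Omega> (carrier G) (\<lambda>g. \<rho> g v)"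
  obtain \<mu> u where \<mu>: "\<mu> \<ge> 0" and u: "u \<in> zero_sum \<Omega>" "u \<noteq> 0" "?Q u = \<mu> * nsq \<Omega> u"
    and le: "\<And>w. w \<in> zero_sum \<Omega> \<Longrightarrow> ?Q w \<le> \<mu> * nsq \<Omega> w"
    using qform_maximum[OF finite_space zero_sum_subset closed_zero_sum subspace_zero_sum
        zero_sum_nontrivial[OF finite_space card_space]] by metis
  \<comment> \<open>Because \<mu> is the maximum, this quadratic equation cuts out a subspace, the
    top eigenspace.\<close>
  define X where "X = {u \<in> zero_sum \<Omega>. ?Q u = \<mu> * nsq \<Omega> u}"
  have "rep.subrep X"
    unfolding rep.subrep_def
  proof (intro conjI ballI)
    show "fs.subspace X"
      unfolding X_def by (rule subspace_qform_maximisers[OF subspace_zero_sum le])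
    show "X \<subseteq> perm_space \<Omega>"
      using zero_sum_subset by (auto simp: X_def)
    show "\<rho> g x \<in> X" if "g \<in> carrier G" "x \<in> X" for g x
      using that rep_zero_sum qform_orbit_invariant[OF _ subsetD[OF zero_sum_subset] v] nsq_rep
      by (auto simp: X_def)
  qed
  moreover have "X \<noteq> {0}"
    using u by (auto simp: X_def)
  moreover have "X \<subseteq> zero_sum \<Omega>"
    by (auto simp: X_def)
  ultimately obtain W where W: "rep.nontrivial_irreducible W" "W \<subseteq> X"
    by (rule nontrivial_irreducible_exists)
  \<comment> \<open>A basis of \<open>W\<close> has at least \<open>rep.min_degree\<close> elements,
    and each contributes \<mu> to the trace.\<close>
  obtain A where A: "A \<subseteq> W" "fs.independent A" "W \<subseteq> fs.span A" "card A = fs.dim W"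
    using fs.basis_exists[of W] by metis
  have sW: "fs.subspace W" "W \<subseteq> perm_space \<Omega>"
    using W(1) rep.subrepD by (auto simp: rep.nontrivial_irreducible_def rep.irreducible_subrep_def)
  have "finite A"
    using rep.independent_card_le_dim[OF span_perm_space sW(2) A(1,2)] by blast
  moreover have "fs.span A \<subseteq> X"
    using fs.span_minimal[OF A(1) sW(1)] W(2) by blast
  ultimately have "card A * \<mu> \<le> (\<Sum>g\<in>carrier G. nsq \<Omega> (\<rho> g v))"
    using A(1,2) sW(2) by (intro card_independent_mult_le finite_space) (auto simp: X_def)
  also have "\<dots> = order G * nsq \<Omega> v"
    by (simp add: nsq_rep order_def)
  finally have "card A * \<mu> \<le> order G * nsq \<Omega> v" .
  moreover have "rep.min_degree * \<mu> \<le> card A * \<mu>"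
    using rep.min_degree_le[OF W(1)] A(4) \<mu> by (intro mult_right_mono) auto
  ultimately have "\<mu> \<le> order G / rep.min_degree * nsq \<Omega> v"
    using min_degree_pos by (simp add: field_simps)
  then have "\<mu> * nsq \<Omega> w \<le> order G / rep.min_degree * nsq \<Omega> v * nsq \<Omega> w"
    by (intro mult_right_mono) auto
  then show ?thesis
    using le[OF w] by linarith
qed

definition set_op :: "'a set \<Rightarrow> ('b \<Rightarrow> complex) \<Rightarrow> 'b \<Rightarrow> complex" where
  "set_op S w = (\<Sum>s\<in>S. \<rho> s w)"

lemma set_op_closed:
  assumes "S \<subseteq> carrier G" "rep.subrep W" "w \<in> W"
  shows "set_op S w \<in> W"
  unfolding set_op_def using assms by (intro fs.subspace_sum) (auto simp: rep.subrepD)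

text \<open>Write \<open>N\<close> for the squared norm of \<open>T w\<close>. It is the sum of the
  products of \<open>T w\<close> with \<open>\<rho> s w\<close>, so Cauchy--Schwarz over
  \<open>S\<close> bounds \<open>N\<^sup>2\<close> by \<open>card S\<close> times the orbit form of
  \<open>w\<close> at \<open>T w\<close>. That form is bounded by a multiple of \<open>N\<close>,
  and one factor \<open>N\<close> cancels.\<close>

lemma set_op_le_degree:
  assumes S: "S \<subseteq> carrier G" and w: "w \<in> zero_sum \<Omega>"
  shows "nsq \<Omega> (set_op S w) \<le> order G / rep.min_degree * card S * nsq \<Omega> w"
proof (cases "nsq \<Omega> (set_op S w) = 0")
  case True
  then show ?thesis by simp
next
  case False
  let ?N = "nsq \<Omega> (set_op S w)"
  have finS: "finite S"
    using S finite_carrier finite_subset by blast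
  have Tw: "set_op S w \<in> zero_sum \<Omega>"
    by (rule set_op_closed[OF S subrep_zero_sum w])
  have "complex_of_real ?N = (\<Sum>s\<in>S. ip \<Omega> (set_op S w) (\<rho> s w))"
    unfolding ip_self[symmetric] by (subst (2) set_op_def) (rule ip_sum_right)
  then have "?N = cmod (\<Sum>s\<in>S. ip \<Omega> (set_op S w) (\<rho> s w))"
    by (metis abs_of_nonneg norm_of_real nsq_nonneg)
  also have "\<dots> \<le> (\<Sum>s\<in>S. cmod (ip \<Omega> (set_op S w) (\<rho> s w)))"
    by (rule norm_sum)
  finally have "?N\<^sup>2 \<le> (\<Sum>s\<in>S. cmod (ip \<Omega> (set_op S w) (\<rho> s w)))\<^sup>2"
    by (intro power_mono) auto
  also have "\<dots> \<le> (\<Sum>s\<in>S. (cmod (ip \<Omega> (set_op S w) (\<rho> s w)))\<^sup>2) * card S"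
    by (rule sum_squared_le_sum_of_squares)
  \<comment> \<open>The sum of squares grows from \<open>S\<close> to the whole group, where the
    orbit form is available.\<close>
  also have "\<dots> \<le> qform \<Omega> (carrier G) (\<lambda>g. \<rho> g w) (set_op S w) * card S"
    unfolding qform_def using S finite_carrier by (intro mult_right_mono sum_mono2) auto
  also have "\<dots> \<le> (order G / rep.min_degree * nsq \<Omega> w * ?N) * card S"
    using qform_orbit_le[OF _ Tw, of w] w zero_sum_subset by (intro mult_right_mono) auto
  finally have "?N * ?N \<le> (order G / rep.min_degree * card S * nsq \<Omega> w) * ?N"
    by (simp add: power2_eq_square mult_ac)
  moreover have "?N > 0"
    using False nsq_nonneg[of \<Omega> "set_op S w"] by linarith
  ultimately show ?thesis
    by (simp only: mult_le_cancel_right_pos)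
qed

subsection \<open>The bound in terms of the multiplicity\<close>

text \<open>Its cardinality is the entry of the matrix of \<open>set_op S\<close> in row
  \<open>x\<close> and column \<open>y\<close>; the target comes first.\<close>

definition transporter :: "'a set \<Rightarrow> 'b \<Rightarrow> 'b \<Rightarrow> 'a set" where
  "transporter S x y = {s \<in> S. \<phi> s y = x}"

lemma set_op_eq_ip:
  assumes S: "S \<subseteq> carrier G" and x: "x \<in> \<Omega>"
  shows "set_op S w x = ip \<Omega> w (\<lambda>y. of_nat (card (transporter S x y)))"
proof -
  have finS: "finite S"
    using S finite_carrier finite_subset by blast
  have "set_op S w x = (\<Sum>s\<in>S. w (\<phi> (inv s) x))"
    unfolding set_op_def sum_fun_apply using x by (intro sum.cong) (auto simp: rep_apply)
  also have "\<dots> = (\<Sum>s\<in>S. \<Sum>y\<in>\<Omega>. w y * of_bool (\<phi> s y = x))"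
  proof (intro sum.cong refl)
    fix s assume "s \<in> S"
    then have s: "s \<in> carrier G" using S by blast
    have "(\<Sum>y\<in>\<Omega>. w y * of_bool (\<phi> s y = x)) = (\<Sum>y\<in>\<Omega>. if \<phi> (inv s) x = y then w y else 0)"
      using act_inv_act[OF s] act_act_inv[OF s x] by (intro sum.cong) auto
    also have "\<dots> = w (\<phi> (inv s) x)"
      using act_closed[of "inv s" x] s x finite_space by simp
    finally show "w (\<phi> (inv s) x) = (\<Sum>y\<in>\<Omega>. w y * of_bool (\<phi> s y = x))" ..
  qed
  also have "\<dots> = (\<Sum>y\<in>\<Omega>. w y * (\<Sum>s\<in>S. of_bool (\<phi> s y = x)))"
    by (subst sum.swap) (simp add: sum_distrib_left)
  also have "\<dots> = ip \<Omega> w (\<lambda>y. of_nat (card (transporter S x y)))"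
    using finS by (simp add: ip_def transporter_def Int_def)
  finally show ?thesis .
qed

text \<open>Every \<open>s\<close> sends \<open>y\<close> to exactly one point, so each column of
  the matrix adds up to \<open>card S\<close>.\<close>

lemma sum_card_transporter:
  assumes S: "S \<subseteq> carrier G"
  shows "(\<Sum>x\<in>\<Omega>. \<Sum>y\<in>\<Omega>. card (transporter S x y)) = card S * card \<Omega>"
proof -
  have finS: "finite S"
    using S finite_carrier finite_subset by blast
  have "(\<Sum>x\<in>\<Omega>. card (transporter S x y)) = card S" if y: "y \<in> \<Omega>" for y
  proof -
    have "card S = card (\<Union>x\<in>\<Omega>. transporter S x y)"
      using act_closed S y by (intro arg_cong[where f = card]) (auto simp: transporter_def)
    also have "\<dots> = (\<Sum>x\<in>\<Omega>. card (transporter S x y))"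
      using finS finite_space by (intro card_UN_disjoint) (auto simp: transporter_def)
    finally show ?thesis by simp
  qed
  then show ?thesis
    by (subst sum.swap) simp
qed

text \<open>Exhibits \<open>T\<^sup>* T\<close> as a group algebra element: by unitarity the adjoint
  of \<open>\<rho> s\<close> is \<open>\<rho> (inv s)\<close>.\<close>

lemma ip_set_op_adjoint:
  assumes S: "S \<subseteq> carrier G" and u: "u \<in> perm_space \<Omega>" and w: "w \<in> perm_space \<Omega>"
  shows "ip \<Omega> (rep.alg_op (S \<times> S) (\<lambda>(s, t). inv s \<otimes> t) u) w = ip \<Omega> (set_op S u) (set_op S w)"
proof -
  have "ip \<Omega> (rep.alg_op (S \<times> S) (\<lambda>(s, t). inv s \<otimes> t) u) w
      = (\<Sum>s\<in>S. \<Sum>t\<in>S. ip \<Omega> (\<rho> (inv s \<otimes> t) u) w)"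
    by (simp add: rep.alg_op_def ip_sum_left sum.cartesian_product case_prod_unfold)
  also have "\<dots> = (\<Sum>s\<in>S. \<Sum>t\<in>S. ip \<Omega> (\<rho> t u) (\<rho> s w))"
  proof (intro sum.cong refl)
    fix s t assume "s \<in> S" "t \<in> S"
    then show "ip \<Omega> (\<rho> (inv s \<otimes> t) u) w = ip \<Omega> (\<rho> t u) (\<rho> s w)"
      using S u w by (simp add: subset_iff rep.rep_mult ip_rep_inv)
  qed
  also have "\<dots> = ip \<Omega> (set_op S u) (set_op S w)"
    unfolding set_op_def ip_sum_left ip_sum_right ..
  finally show ?thesis .
qed

lemma set_op_le_multiplicity:
  assumes S: "S \<subseteq> carrier G" and w: "w \<in> zero_sum \<Omega>"
    and l: "\<And>x y. x \<in> \<Omega> \<Longrightarrow> y \<in> \<Omega> \<Longrightarrow> card (transporter S x y) \<le> l"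
  shows "nsq \<Omega> (set_op S w) \<le> l * card \<Omega> / rep.min_multiplicity * card S * nsq \<Omega> w"
proof -
  define b :: "'b \<Rightarrow> 'b \<Rightarrow> complex" where "b x = (\<lambda>y. of_nat (card (transporter S x y)))" for x
  let ?Q = "qform \<Omega> \<Omega> b" and ?h = "\<lambda>(s, t). inv s \<otimes> t"
  let ?A = "rep.alg_op (S \<times> S) ?h"
  have h: "?h i \<in> carrier G" if "i \<in> S \<times> S" for i
    using that S by auto
  have ip_b: "ip \<Omega> w (b x) = set_op S w x" if "x \<in> \<Omega>" for x w
    using set_op_eq_ip[OF S that] by (simp add: b_def)
  have Q: "?Q w = nsq \<Omega> (set_op S w)" for w
    by (simp add: qform_def nsq_def ip_b)
  obtain \<mu> u where \<mu>: "\<mu> \<ge> 0" and u: "u \<in> zero_sum \<Omega>" "u \<noteq> 0" "?Q u = \<mu> * nsq \<Omega> u"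
    and le: "\<And>w. w \<in> zero_sum \<Omega> \<Longrightarrow> ?Q w \<le> \<mu> * nsq \<Omega> w"
    using qform_maximum[OF finite_space zero_sum_subset closed_zero_sum subspace_zero_sum
        zero_sum_nontrivial[OF finite_space card_space]] by metis
  have uV: "u \<in> perm_space \<Omega>"
    using u(1) zero_sum_subset by blast
  have eigen: "?A u = fun_scale (of_real \<mu>) u"
  proof -
    \<comment> \<open>\<open>?A\<close> preserves \<open>zero_sum \<Omega>\<close>, so the weak
      eigenvalue equation may be tested on the defect \<open>?d\<close> itself, which then has norm
      zero.\<close>
    let ?d = "?A u - fun_scale (of_real \<mu>) u"
    have d: "?d \<in> zero_sum \<Omega>"
      using u(1) by (intro fs.subspace_diff fs.subspace_scale subspace_zero_sum rep.alg_op_closed[OF h subrep_zero_sum])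
    have dV: "?d \<in> perm_space \<Omega>"
      using d zero_sum_subset by blast
    have "(\<Sum>x\<in>\<Omega>. ip \<Omega> u (b x) * cnj (ip \<Omega> ?d (b x))) = of_real \<mu> * ip \<Omega> u ?d"
      using qform_maximiser_iff[OF subspace_zero_sum le u(1)] u(3) d by blast
    moreover have "(\<Sum>x\<in>\<Omega>. ip \<Omega> u (b x) * cnj (ip \<Omega> ?d (b x))) = ip \<Omega> (set_op S u) (set_op S ?d)"
      by (simp add: ip_b ip_def[of \<Omega> "set_op S u"])
    ultimately have "ip \<Omega> (?A u) ?d = of_real \<mu> * ip \<Omega> u ?d"
      using ip_set_op_adjoint[OF S uV dV] by simp
    then have "ip \<Omega> ?d ?d = 0"
      by (subst ip_diff_left) (simp add: ip_scale_left)
    then have "nsq \<Omega> ?d = 0"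
      by (simp only: ip_self of_real_eq_0_iff)
    then have "?d = 0"
      using nsq_eq_0_iff[OF finite_space dV] by blast
    then show ?thesis
      unfolding right_minus_eq .
  qed
  obtain g where g: "g \<in> carrier G" "\<rho> g u \<noteq> u"
    using fixed_zero_sum[OF u(1)] u(2) by blast
  obtain A where A: "finite A" "fs.independent A"
    "A \<subseteq> {u \<in> perm_space \<Omega>. ?A u = fun_scale (of_real \<mu>) u}" "rep.min_multiplicity \<le> card A"
    by (rule rep.min_multiplicity_le_eigen[OF decomposition_exists h uV eigen g])
  have span: "fs.span A \<subseteq> {u \<in> perm_space \<Omega>. ?A u = fun_scale (of_real \<mu>) u}"
    using A(3) rep.subspace_alg_op_eigen[OF h] by (rule fs.span_minimal)
  \<comment> \<open>\<open>A\<close> need not lie in \<open>zero_sum \<Omega>\<close>: for any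
    eigenvector of \<open>?A\<close> with eigenvalue \<mu> the adjoint identity gives the equality
    that the trace bound requires.\<close>
  have "card A * \<mu> \<le> (\<Sum>x\<in>\<Omega>. nsq \<Omega> (b x))"
  proof (intro card_independent_mult_le finite_space A)
    show "A \<subseteq> perm_space \<Omega>"
      using A(3) by blast
    fix z assume "z \<in> fs.span A"
    then have z: "z \<in> perm_space \<Omega>" "?A z = fun_scale (of_real \<mu>) z"
      using span by auto
    have "complex_of_real (?Q z) = of_real (\<mu> * nsq \<Omega> z)"
      using ip_set_op_adjoint[OF S z(1) z(1)] z(2) by (simp add: Q ip_scale_left ip_self)
    then show "?Q z = \<mu> * nsq \<Omega> z"
      using of_real_eq_iff by blast
  qed
  \<comment> \<open>An entry is at most \<open>l\<close>, so its square is at most \<open>l\<close>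
    times the entry, and only the total of the entries remains.\<close>
  also have "\<dots> \<le> (\<Sum>x\<in>\<Omega>. \<Sum>y\<in>\<Omega>. real l * card (transporter S x y))"
    unfolding nsq_def b_def using l by (intro sum_mono) (auto simp: power2_eq_square intro!: mult_right_mono)
  also have "\<dots> = real l * real (\<Sum>x\<in>\<Omega>. \<Sum>y\<in>\<Omega>. card (transporter S x y))"
    by (simp add: sum_distrib_left)
  also have "\<dots> = l * card \<Omega> * card S"
    unfolding sum_card_transporter[OF S] by simp
  finally have "card A * \<mu> \<le> l * card \<Omega> * card S" by simp
  moreover have "rep.min_multiplicity * \<mu> \<le> card A * \<mu>"
    using A(4) \<mu> by (intro mult_right_mono) auto
  ultimately have "rep.min_multiplicity * \<mu> \<le> l * card \<Omega> * card S"
    by linarith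
  then have "\<mu> \<le> l * card \<Omega> / rep.min_multiplicity * card S"
    using min_multiplicity_pos by (simp add: field_simps)
  then have "\<mu> * nsq \<Omega> w \<le> l * card \<Omega> / rep.min_multiplicity * card S * nsq \<Omega> w"
    by (intro mult_right_mono) auto
  then show ?thesis
    using le[OF w] by (simp add: Q)
qed

section \<open>Transporters inside two-sided translates of the stabiliser\<close>

lemma finite_translate_inter:
  "finite {card ((g1 <# H #> g2) \<inter> S) | g1 g2. g1 \<in> carrier G \<and> g2 \<in> carrier G}"
proof (rule finite_subset)
  show "{card ((g1 <# H #> g2) \<inter> S) | g1 g2. g1 \<in> carrier G \<and> g2 \<in> carrier G}
      \<subseteq> (\<lambda>(g1, g2). card ((g1 <# H #> g2) \<inter> S)) ` (carrier G \<times> carrier G)"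
    by auto
qed (use finite_carrier in simp)

text \<open>Transitivity gives \<open>g1\<close> taking \<omega> to \<open>x\<close> and
  \<open>g2\<close> taking \<open>y\<close> to \<omega>. Everything that takes \<open>y\<close> to
  \<open>x\<close> then lies in \<open>g1 H g2\<close>.\<close>

lemma card_transporter_le:
  assumes S: "S \<subseteq> carrier G" and \<omega>: "\<omega> \<in> \<Omega>" and x: "x \<in> \<Omega>" and y: "y \<in> \<Omega>"
  shows "card (transporter S x y) \<le> max_translate_inter G (stabilizer G \<phi> \<omega>) S"
proof -
  let ?H = "stabilizer G \<phi> \<omega>"
  obtain g1 where g1: "g1 \<in> carrier G" "\<phi> g1 \<omega> = x"
    using unique_orbit[OF \<omega> x] by blast
  obtain g2 where g2: "g2 \<in> carrier G" "\<phi> g2 y = \<omega>"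
    using unique_orbit[OF y \<omega>] by blast
  have "transporter S x y \<subseteq> (g1 <# ?H #> g2) \<inter> S"
  proof
    fix s assume "s \<in> transporter S x y"
    then have s: "s \<in> S" "s \<in> carrier G" "\<phi> s y = x"
      using S by (auto simp: transporter_def)
    define k where "k = inv g1 \<otimes> (s \<otimes> inv g2)"
    have "\<phi> (inv g2) \<omega> = y" "\<phi> (inv g1) x = \<omega>"
      using orbit_sym_aux g1 g2 \<omega> y by auto
    then have "\<phi> k \<omega> = \<omega>"
      using g1 g2 s \<omega> y by (simp add: k_def composition_rule)
    then have "k \<in> ?H"
      using g1 g2 s by (simp add: stabilizer_def k_def)
    moreover have "s = g1 \<otimes> k \<otimes> g2"
    proof -
      have "g1 \<otimes> k = s \<otimes> inv g2"
        using g1 g2 s by (simp add: k_def flip: rep.m_assoc)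
      then show ?thesis
        using g2 s by (simp add: rep.m_assoc)
    qed
    ultimately show "s \<in> (g1 <# ?H #> g2) \<inter> S"
      using s(1) by (auto simp: l_coset_def r_coset_def)
  qed
  moreover have "finite S"
    using S finite_carrier finite_subset by blast
  ultimately have "card (transporter S x y) \<le> card ((g1 <# ?H #> g2) \<inter> S)"
    by (intro card_mono) auto
  also have "\<dots> \<le> max_translate_inter G ?H S"
    unfolding max_translate_inter_def using g1 g2 finite_translate_inter by (intro Max_ge) blast+
  finally show ?thesis .
qed

text \<open>Any \<open>s\<close> in \<open>S\<close> belongs to the transporter from \<omega> to its
  own image of \<omega>.\<close>

lemma max_translate_inter_pos:
  assumes S: "S \<subseteq> carrier G" "S \<noteq> {}" and \<omega>: "\<omega> \<in> \<Omega>"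
  shows "max_translate_inter G (stabilizer G \<phi> \<omega>) S > 0"
proof -
  obtain s where s: "s \<in> S"
    using S(2) by blast
  have "finite (transporter S (\<phi> s \<omega>) \<omega>)" "s \<in> transporter S (\<phi> s \<omega>) \<omega>"
    using S(1) s finite_carrier finite_subset[of S] by (auto simp: transporter_def)
  then have "card (transporter S (\<phi> s \<omega>) \<omega>) > 0"
    using card_gt_0_iff by blast
  also have "\<dots> \<le> max_translate_inter G (stabilizer G \<phi> \<omega>) S"
    using S(1) s \<omega> act_closed by (intro card_transporter_le) auto
  finally show ?thesis .
qed

section \<open>From an operator bound on zero-sum functions to the size of
  \<open>S(\<Gamma>)\<close>\<close>

lemma card_set_act_gt:
  fixes L :: real
  assumes S: "S \<subseteq> carrier G" "S \<noteq> {}" and \<Gamma>: "\<Gamma> \<subseteq> \<Omega>" "\<Gamma> \<noteq> {}" and L: "L > 0"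
    and norm: "\<And>w. w \<in> zero_sum \<Omega> \<Longrightarrow> nsq \<Omega> (set_op S w) \<le> L * card S * nsq \<Omega> w"
  shows "card (set_act \<phi> S \<Gamma>) > card \<Omega> / (1 + L * card \<Omega> / (card S * card \<Gamma>))"
proof -
  define Z where "Z = set_act \<phi> S \<Gamma>"
  define n s c z where "n = real (card \<Omega>)" and "s = real (card S)" and "c = real (card \<Gamma>)"
    and "z = real (card Z)"
  have fin: "finite S" "finite \<Gamma>"
    using S \<Gamma> finite_carrier finite_space finite_subset by blast+
  have Z: "Z \<subseteq> \<Omega>" "Z \<noteq> {}"
    using S \<Gamma> act_closed by (auto simp: Z_def set_act_def)
  then have finZ: "finite Z"
    using finite_space finite_subset by blast
  have pos: "n > 0" "s > 0" "c > 0" "z > 0"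
    using fin S \<Gamma> Z finZ finite_space card_space by (auto simp: n_def s_def c_def z_def card_gt_0_iff)
  \<comment> \<open>\<open>F\<close> is \<open>T\<close> applied to the indicator of \<Gamma>, kept
    real-valued.\<close>
  define F :: "'b \<Rightarrow> real" where "F x = (\<Sum>s\<in>S. of_bool (\<phi> (inv s) x \<in> \<Gamma>))" for x
  have sum_ind: "(\<Sum>x\<in>\<Omega>. of_bool (x \<in> \<Gamma>)) = c"
    using \<Gamma>(1) finite_space by (simp add: c_def Int_absorb1)
  have sum_F: "(\<Sum>x\<in>\<Omega>. F x) = s * c"
  proof -
    have "(\<Sum>x\<in>\<Omega>. of_bool (\<phi> (inv s) x \<in> \<Gamma>)) = c" if "s \<in> S" for s
      using that S(1) bij_act[of "inv s"] sum_ind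
      by (subst sum.reindex_bij_betw[of "\<phi> (inv s)" \<Omega> \<Omega> "\<lambda>x. of_bool (x \<in> \<Gamma>)"]) auto
    then show ?thesis
      unfolding F_def by (subst sum.swap) (simp add: s_def)
  qed
  have F_out: "F x = 0" if "x \<in> \<Omega>" "x \<notin> Z" for x
  proof -
    have "\<phi> (inv s) x \<notin> \<Gamma>" if "s \<in> S" for s
    proof
      assume "\<phi> (inv s) x \<in> \<Gamma>"
      then have "\<phi> s (\<phi> (inv s) x) \<in> Z"
        using \<open>s \<in> S\<close> by (auto simp: Z_def set_act_def)
      then show False
        using act_act_inv[of s x] that S(1) \<open>x \<in> \<Omega>\<close> \<open>x \<notin> Z\<close> by auto
    qed
    then show ?thesis
      by (simp add: F_def)
  qed
  \<comment> \<open>The indicator of \<Gamma> minus its mean \<open>c / n\<close>, that is, its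
    zero-sum part.\<close>
  define f :: "'b \<Rightarrow> complex" where "f x = (if x \<in> \<Omega> then of_real (of_bool (x \<in> \<Gamma>) - c / n) else 0)" for x
  \<comment> \<open>The variance identity, for a function with total \<open>a\<close> and mean
    \<open>a / n\<close>; it serves both for the indicator and for \<open>F\<close>.\<close>
  have square: "(\<Sum>x\<in>\<Omega>. (h x - a / n)\<^sup>2) = (\<Sum>x\<in>\<Omega>. (h x)\<^sup>2) - a\<^sup>2 / n"
    if "(\<Sum>x\<in>\<Omega>. h x) = a" for h :: "'b \<Rightarrow> real" and a
  proof -
    have "(\<Sum>x\<in>\<Omega>. (h x - a / n)\<^sup>2) = (\<Sum>x\<in>\<Omega>. (h x)\<^sup>2 - 2 * (a / n) * h x + (a / n)\<^sup>2)"
      by (simp add: power2_diff algebra_simps)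
    also have "\<dots> = (\<Sum>x\<in>\<Omega>. (h x)\<^sup>2) - 2 * (a / n) * a + n * (a / n)\<^sup>2"
      unfolding sum.distrib sum_subtractf sum_distrib_left[symmetric] that by (simp add: n_def)
    also have "\<dots> = (\<Sum>x\<in>\<Omega>. (h x)\<^sup>2) - a\<^sup>2 / n"
      using pos(1) by (simp add: power2_eq_square field_simps)
    finally show ?thesis .
  qed
  have f: "f \<in> zero_sum \<Omega>"
  proof -
    have "(\<Sum>x\<in>\<Omega>. f x) = of_real (\<Sum>x\<in>\<Omega>. of_bool (x \<in> \<Gamma>) - c / n)"
      by (simp add: f_def)
    also have "\<dots> = 0"
      unfolding sum_subtractf sum_ind using pos(1) by (simp add: n_def)
    finally show ?thesis
      by (simp add: zero_sum_def perm_space_def f_def)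
  qed
  have "nsq \<Omega> f = (\<Sum>x\<in>\<Omega>. (of_bool (x \<in> \<Gamma>) - c / n)\<^sup>2)"
    unfolding nsq_def f_def by (intro sum.cong) (auto simp only: norm_of_real power2_abs if_True)
  also have "\<dots> = (\<Sum>x\<in>\<Omega>. (of_bool (x \<in> \<Gamma>))\<^sup>2) - c\<^sup>2 / n"
    by (rule square[OF sum_ind])
  \<comment> \<open>Discarding the positive term \<open>c\<^sup>2 / n\<close> is the source of the
    strict inequality in the conclusion.\<close>
  also have "\<dots> < c"
    using sum_ind pos by (simp add: power2_eq_square flip: of_bool_conj)
  finally have nsq_f: "nsq \<Omega> f < c" .
  \<comment> \<open>\<open>T\<close> multiplies constants by \<open>s\<close>, so \<open>T f\<close>
    is \<open>F\<close> minus its mean.\<close>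
  have "nsq \<Omega> (set_op S f) = (\<Sum>x\<in>\<Omega>. (F x - s * c / n)\<^sup>2)"
    unfolding nsq_def
  proof (intro sum.cong refl)
    fix x assume x: "x \<in> \<Omega>"
    have "set_op S f x = (\<Sum>s\<in>S. of_real (of_bool (\<phi> (inv s) x \<in> \<Gamma>) - c / n))"
      unfolding set_op_def sum_fun_apply
      using S(1) x act_closed by (intro sum.cong) (auto simp: rep_apply f_def subset_iff)
    also have "\<dots> = of_real (F x - s * c / n)"
      by (simp add: F_def sum_subtractf s_def)
    finally show "(cmod (set_op S f x))\<^sup>2 = (F x - s * c / n)\<^sup>2"
      by (simp only: norm_of_real power2_abs)
  qed
  also have "\<dots> = (\<Sum>x\<in>\<Omega>. (F x)\<^sup>2) - (s * c)\<^sup>2 / n"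
    by (rule square[OF sum_F])
  finally have "(\<Sum>x\<in>\<Omega>. (F x)\<^sup>2) - (s * c)\<^sup>2 / n \<le> L * s * nsq \<Omega> f"
    using norm[OF f] by (simp add: s_def)
  also have "\<dots> < L * s * c"
    using nsq_f L pos by (intro mult_strict_left_mono) auto
  finally have upper: "(\<Sum>x\<in>\<Omega>. (F x)\<^sup>2) < (s * c)\<^sup>2 / n + L * (s * c)"
    by simp
  \<comment> \<open>\<open>F\<close> vanishes outside \<open>Z\<close>, so Cauchy--Schwarz costs a
    factor \<open>z\<close> and not \<open>n\<close>.\<close>
  have "(s * c)\<^sup>2 = (\<Sum>x\<in>Z. F x)\<^sup>2"
    using F_out Z(1) finite_space unfolding sum_F[symmetric]
    by (intro arg_cong[where f = "\<lambda>x. x\<^sup>2"] sum.mono_neutral_right) auto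
  also have "\<dots> \<le> (\<Sum>x\<in>Z. (F x)\<^sup>2) * z"
    unfolding z_def by (rule sum_squared_le_sum_of_squares)
  also have "\<dots> \<le> (\<Sum>x\<in>\<Omega>. (F x)\<^sup>2) * z"
    using Z(1) finite_space pos by (intro mult_right_mono sum_mono2) auto
  also have "\<dots> < ((s * c)\<^sup>2 / n + L * (s * c)) * z"
    using upper pos by (intro mult_strict_right_mono) auto
  finally have "(s * c) * (s * c) < (s * c) * ((s * c / n + L) * z)"
    by (simp add: power2_eq_square algebra_simps)
  then have main: "s * c < (s * c / n + L) * z"
    using pos by simp
  have "1 + L * n / (s * c) > 0"
    using pos L by (intro add_pos_pos divide_pos_pos mult_pos_pos) auto
  moreover have "n < z * (1 + L * n / (s * c))"
    using main pos by (simp add: field_simps)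
  ultimately have "n / (1 + L * n / (s * c)) < z"
    by (simp add: pos_divide_less_eq)
  then show ?thesis
    by (simp add: n_def s_def c_def z_def Z_def)
qed

end

section \<open>From the two operator bounds to the inequalities of the theorem\<close>

text \<open>The denominator \<open>1 + b\<close> is at most 2 or at most \<open>2 * b\<close>,
  according to whether \<open>b\<close> is at most 1.\<close>

lemma min_half_le_divide:
  fixes n b :: real
  assumes "n > 0" "b > 0"
  shows "min (n / 2) (n / (2 * b)) \<le> n / (1 + b)"
proof (cases "b \<le> 1")
  case True
  then have "n / 2 \<le> n / (1 + b)"
    using assms by (intro divide_left_mono) auto
  then show ?thesis by (simp add: min_le_iff_disj)
next
  case False
  then have "n / (2 * b) \<le> n / (1 + b)"
    using assms by (intro divide_left_mono) auto
  then show ?thesis by (simp add: min_le_iff_disj)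
qed

theorem theorem4:
  fixes G :: "('a, 'm) monoid_scheme" and \<phi> :: "'a \<Rightarrow> 'b \<Rightarrow> 'b"
    and \<Omega> \<Gamma> :: "'b set" and \<omega> :: 'b and H S :: "'a set" and d m l :: nat
  assumes "transitive_action G \<Omega> \<phi>"
    and "finite (carrier G)" and "finite \<Omega>" and "card \<Omega> \<ge> 2"
    and "S \<subseteq> carrier G" and "S \<noteq> {}" and "\<Gamma> \<subseteq> \<Omega>" and "\<Gamma> \<noteq> {}"
    and "\<omega> \<in> \<Omega>" and "H = stabilizer G \<phi> \<omega>"
    and "d = perm_min_degree G \<Omega> \<phi>"
    and "m = perm_min_multiplicity G \<Omega> \<phi>"
    and "l = max_translate_inter G H S"
  shows
    "real (card (set_act \<phi> S \<Gamma>)) >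
       real (card \<Omega>) / (1 + (real (order G) * real (card \<Omega>)) / (real d * real (card S) * real (card \<Gamma>))) \<and>
     real (card \<Omega>) / (1 + (real (order G) * real (card \<Omega>)) / (real d * real (card S) * real (card \<Gamma>)))
       \<ge> min (real (card \<Omega>) / 2) ((real d * real (card S) * real (card \<Gamma>)) / (2 * real (order G))) \<and>
     real (card (set_act \<phi> S \<Gamma>)) >
       real (card \<Omega>) / (1 + (real l * (real (card \<Omega>))^2) / (real m * real (card S) * real (card \<Gamma>))) \<and>
     real (card \<Omega>) / (1 + (real l * (real (card \<Omega>))^2) / (real m * real (card S) * real (card \<Gamma>)))
       \<ge> min (real (card \<Omega>) / 2) ((real m * real (card S) * real (card \<Gamma>)) / (2 * real l * real (card \<Omega>))) \<and>
     (\<forall>k::real. k > 0 \<and>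
        real (card S) \<ge> min (k * (real (order G) / real d)) (k * (real l * real (card \<Omega>) / real m))
        \<longrightarrow> real (card (set_act \<phi> S \<Gamma>)) > 1/2 * min (real (card \<Omega>)) (k * real (card \<Gamma>)))"
proof -
  interpret finite_transitive_action G \<Omega> \<phi>
    using assms(1-4) by (intro finite_transitive_action.intro finite_transitive_action_axioms.intro)
  define n s c g z where "n = real (card \<Omega>)" and "s = real (card S)" and "c = real (card \<Gamma>)"
    and "g = real (order G)" and "z = real (card (set_act \<phi> S \<Gamma>))"
  have d: "d = rep.min_degree" and m: "m = rep.min_multiplicity"
    using assms(11,12) by (simp_all add: perm_min_degree_def perm_min_multiplicity_def)
  have fin: "finite S" "finite \<Gamma>"
    using assms finite_subset by blast+
  have "carrier G \<noteq> {}"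
    using assms(5,6) by blast
  \<comment> \<open>Division by zero yields 0, so the positivity of \<open>d\<close>,
    \<open>m\<close> and \<open>l\<close> has to be secured before any quotient is
    rearranged.\<close>
  then have pos: "n > 0" "s > 0" "c > 0" "g > 0" "real d > 0" "real m > 0" "real l > 0"
    using fin assms min_degree_pos min_multiplicity_pos max_translate_inter_pos
    by (auto simp: n_def s_def c_def g_def d m order_def card_gt_0_iff)
  \<comment> \<open>The two chains differ only in the constant \<open>L\<close> of the operator
    bound, which is \<open>g / d\<close> or \<open>l * n / m\<close>. The consequence for a given
    \<open>k\<close> needs no more than \<open>k * L \<le> s\<close>.\<close>
  have expand: "n / (1 + L * n / (s * c)) < z \<and>
      min (n / 2) (s * c / (2 * L)) \<le> n / (1 + L * n / (s * c)) \<and>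
      (\<forall>k. k > 0 \<longrightarrow> k * L \<le> s \<longrightarrow> 1/2 * min n (k * c) < z)"
    if L: "L > 0" and "\<And>w. w \<in> zero_sum \<Omega> \<Longrightarrow> nsq \<Omega> (set_op S w) \<le> L * card S * nsq \<Omega> w" for L :: real
  proof (intro conjI allI impI)
    show lower: "n / (1 + L * n / (s * c)) < z"
      using card_set_act_gt[OF assms(5-8) that] by (simp add: n_def s_def c_def z_def)
    \<comment> \<open>With \<open>b = L * n / (s * c)\<close> the second term of the minimum in
      \<open>min_half_le_divide\<close> takes the required form.\<close>
    have "n / (2 * (L * n / (s * c))) = s * c / (2 * L)"
      using pos L by (simp add: field_simps)
    then show min: "min (n / 2) (s * c / (2 * L)) \<le> n / (1 + L * n / (s * c))"
      using min_half_le_divide[of n "L * n / (s * c)"] pos L by simp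
    fix k :: real assume k: "k > 0" "k * L \<le> s"
    have "k * c / 2 = k * L * c / (2 * L)"
      using L by simp
    also have "\<dots> \<le> s * c / (2 * L)"
      using k pos L by (intro divide_right_mono mult_right_mono) auto
    finally have "1/2 * min n (k * c) \<le> min (n / 2) (s * c / (2 * L))"
      by (auto simp: min_def)
    then show "1/2 * min n (k * c) < z"
      using lower min by linarith
  qed
  have deg: "n / (1 + g / d * n / (s * c)) < z \<and>
      min (n / 2) (s * c / (2 * (g / d))) \<le> n / (1 + g / d * n / (s * c)) \<and>
      (\<forall>k. k > 0 \<longrightarrow> k * (g / d) \<le> s \<longrightarrow> 1/2 * min n (k * c) < z)"
    using pos set_op_le_degree[OF assms(5)] by (intro expand) (auto simp: g_def d)
  have mult: "n / (1 + l * n / m * n / (s * c)) < z \<and>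
      min (n / 2) (s * c / (2 * (l * n / m))) \<le> n / (1 + l * n / m * n / (s * c)) \<and>
      (\<forall>k. k > 0 \<longrightarrow> k * (l * n / m) \<le> s \<longrightarrow> 1/2 * min n (k * c) < z)"
    using pos set_op_le_multiplicity[OF assms(5) _ card_transporter_le[OF assms(5,9)]]
    by (intro expand) (auto simp: n_def m assms(10,13))
  have eqs: "g / d * n / (s * c) = g * n / (d * s * c)" "s * c / (2 * (g / d)) = d * s * c / (2 * g)"
    "l * n / m * n / (s * c) = l * n\<^sup>2 / (m * s * c)" "s * c / (2 * (l * n / m)) = m * s * c / (2 * real l * n)"
    by (simp_all add: power2_eq_square mult_ac)
  \<comment> \<open>A lower bound by a minimum means that one of the two bounds on \<open>s\<close>
    holds, and either of them suffices.\<close>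
  show ?thesis
    using deg mult unfolding eqs n_def[symmetric] s_def[symmetric] c_def[symmetric] g_def[symmetric]
      z_def[symmetric] min_le_iff_disj by blast
qed

end
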